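(* Let $K$ be a field of characteristic different from $2$ and $3$, with algebraic closure $\overline{K}$. Let $f\in K[z]$ be a cubic polynomial whose two finite critical points $\gamma_1,\gamma_2\in\overline{K}$ collide at the $\ell$-th iterate for some integer $\ell\geq 2$, i.e. $f^{\ell}(\gamma_1)=f^{\ell}(\gamma_2)$ but $f^{\ell-1}(\gamma_1)\neq f^{\ell-1}(\gamma_2)$. Then $f^{\ell}(\gamma_1)=f^{\ell}(\gamma_2)$ lies in $K$. Furthermore, fix any $x_0\in K$ such that $x_0$ is not periodic under $f$ and no critical point of $f$ lies in the backward orbit of $x_0$. Let $K_n=K(f^{-n}(x_0))$, $K_\infty=\bigcup_{n\geq 0}K_n$, and let $G_{K,\infty}=\operatorname{Gal}(K_\infty/K)$ be the arboreal Galois group for $f$ over $K$ rooted at $x_0$. Then: (1) $G_{K,\infty}$ is isomorphic to a subgroup of $\widetilde{Q}_{\ell,\infty}$, via an appropriate labeling of the tree. (2) $G_{K,\infty}$ is isomorphic to a subgroup of $Q_{\ell,\infty}$ (via an appropriate labeling of the tree) if and only if $-3$ is a square in $K$.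
   Context: Notation: $f^n=f\circ\cdots\circ f$ ($n$ times), $f^0(z)=z$, and $f^{-n}(x_0)$ is the set of solutions of $f^n(z)=x_0$ in $\overline{K}$. The backward orbit of $x_0$ is $\operatorname{Orb}_f^-(x_0)=\coprod_{n\geq 0} f^{-n}(x_0)$. When no critical point of $f$ lies in it, it is identified with the infinite ternary rooted tree $T_{3,\infty}$: the root is $x_0$, the $3^n$ nodes at level $n$ are the elements of $f^{-n}(x_0)$, and each $y\in f^{-n}(x_0)$ with $n\geq1$ is joined by an edge to $f(y)\in f^{-(n-1)}(x_0)$. The group $G_{K,\infty}$ acts faithfully on this tree, so it embeds in the automorphism group $\operatorname{Aut}(T_{3,\infty})$ of the rooted tree. "Isomorphic" for groups acting on a tree means isomorphic equivariantly with respect to the action on the tree; thus $G_{K,\infty}$ is isomorphic to a subgroup of $\widetilde{Q}_{\ell,\infty}$ (resp. $Q_{\ell,\infty}$) if, for some labeling of the tree $\operatorname{Orb}_f^-(x_0)$, the action of every element of $G_{K,\infty}$ lies in the group $\widetilde{Q}_{\ell,\infty}$ (resp. $Q_{\ell,\infty}$) defined using that labeling. A labeling of $T_{3,\infty}$ assigns to each node at level $m$ a unique word $s_1\cdots s_m$ with $s_i\in\{0,1,2\}$, such that the node immediately below (its parent) has label $s_1\cdots s_{m-1}$; the root has the empty label. Given a labeling, for $\sigma\in\operatorname{Aut}(T_{3,\infty})$, a node $y$ and $m\geq 1$, write $\sigma(ys_1\cdots s_m)=\sigma(y)t_1\cdots t_m$; then $(s_1,\dots,s_m)\mapsto(t_1,\dots,t_m)$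 is a permutation of $\{0,1,2\}^m$, and $\operatorname{sgn}_m(\sigma,y)\in\{\pm1\}$ is the sign of this permutation. For $\ell\geq 2$, $\widetilde{Q}_{\ell,\infty}$ is the set of all $\sigma\in\operatorname{Aut}(T_{3,\infty})$ such that $\operatorname{sgn}_\ell(\sigma,y)\operatorname{sgn}_{\ell-1}(\sigma,y)=\operatorname{sgn}_\ell(\sigma,x_0)\operatorname{sgn}_{\ell-1}(\sigma,x_0)$ for every node $y$, where $x_0$ is the root; $Q_{\ell,\infty}$ is the set of all $\sigma\in\widetilde{Q}_{\ell,\infty}$ for which this common product is $+1$. Both are subgroups of $\operatorname{Aut}(T_{3,\infty})$. *)

theory Defs
  imports
    "HOL-Algebra.Algebraic_Closure_Type"
    "HOL-Algebra.Generated_Fields"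
    "HOL-Algebra.Bij"
    "HOL-Combinatorics.Permutations"
begin

section \<open>Rooted ternary trees and their automorphisms\<close>

record 'v rooted_tree =
  tree_nodes :: "'v set"
  tree_root :: 'v
  tree_level :: "'v \<Rightarrow> nat"
  tree_parent :: "'v \<Rightarrow> 'v"  \<comment> \<open>only relevant on the nodes other than the root\<close>

definition tree_adjacent :: "('v, 'b) rooted_tree_scheme \<Rightarrow> 'v \<Rightarrow> 'v \<Rightarrow> bool" where
  "tree_adjacent T u v \<longleftrightarrow> u \<in> tree_nodes T \<and> v \<in> tree_nodes T \<and>
     (u \<noteq> tree_root T \<and> v = tree_parent T u \<or> v \<noteq> tree_root T \<and> u = tree_parent T v)"

text \<open>
  As for \<^const>\<open>Bij\<close>, automorphisms are extensional functions, i.e. undefined outside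
  the set of nodes.
\<close>
definition tree_automorphisms :: "('v, 'b) rooted_tree_scheme \<Rightarrow> ('v \<Rightarrow> 'v) set" where
  "tree_automorphisms T = {\<sigma> \<in> Bij (tree_nodes T). \<sigma> (tree_root T) = tree_root T \<and>
     (\<forall>u\<in>tree_nodes T. \<forall>v\<in>tree_nodes T.
        tree_adjacent T (\<sigma> u) (\<sigma> v) \<longleftrightarrow> tree_adjacent T u v)}"

definition ternary_words :: "nat \<Rightarrow> nat list set" where
  "ternary_words m = {w. length w = m \<and> set w \<subseteq> {0, 1, 2}}"

definition tree_labeling :: "('v, 'b) rooted_tree_scheme \<Rightarrow> ('v \<Rightarrow> nat list) \<Rightarrow> bool" where
  "tree_labeling T lab \<longleftrightarrow>
     (\<forall>m. bij_betw lab {v \<in> tree_nodes T. tree_level T v = m} (ternary_words m)) \<and>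
     (\<forall>v\<in>tree_nodes T. v \<noteq> tree_root T \<longrightarrow> lab (tree_parent T v) = butlast (lab v))"

definition node_of_label :: "('v, 'b) rooted_tree_scheme \<Rightarrow> ('v \<Rightarrow> nat list) \<Rightarrow> nat list \<Rightarrow> 'v" where
  "node_of_label T lab w = inv_into (tree_nodes T) lab w"

text \<open>
  The permutation of the words \<open>s\<close> of length \<open>m\<close> that sends \<open>s\<close> to the \<open>t\<close> with
  \<open>\<sigma>(y s) = \<sigma>(y) t\<close>. It is extended by the identity to all words, because
  \<^const>\<open>sign\<close> is only meaningful for permutations of a whole type.
\<close>
definition label_permutation ::
    "('v, 'b) rooted_tree_scheme \<Rightarrow> ('v \<Rightarrow> nat list) \<Rightarrow> nat \<Rightarrow> ('v \<Rightarrow> 'v) \<Rightarrow> 'v \<Rightarrow> nat list \<Rightarrow> nat list" where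
  "label_permutation T lab m \<sigma> y s =
     (if s \<in> ternary_words m
      then THE t. lab (\<sigma> (node_of_label T lab (lab y @ s))) = lab (\<sigma> y) @ t
      else s)"

definition tree_sgn ::
    "('v, 'b) rooted_tree_scheme \<Rightarrow> ('v \<Rightarrow> nat list) \<Rightarrow> nat \<Rightarrow> ('v \<Rightarrow> 'v) \<Rightarrow> 'v \<Rightarrow> int" where
  "tree_sgn T lab m \<sigma> y = sign (label_permutation T lab m \<sigma> y)"

definition Q_tilde ::
    "('v, 'b) rooted_tree_scheme \<Rightarrow> ('v \<Rightarrow> nat list) \<Rightarrow> nat \<Rightarrow> ('v \<Rightarrow> 'v) set" where
  "Q_tilde T lab l = {\<sigma> \<in> tree_automorphisms T. \<forall>y\<in>tree_nodes T.
     tree_sgn T lab l \<sigma> y * tree_sgn T lab (l - 1) \<sigma> y =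
     tree_sgn T lab l \<sigma> (tree_root T) * tree_sgn T lab (l - 1) \<sigma> (tree_root T)}"

definition Q_group ::
    "('v, 'b) rooted_tree_scheme \<Rightarrow> ('v \<Rightarrow> nat list) \<Rightarrow> nat \<Rightarrow> ('v \<Rightarrow> 'v) set" where
  "Q_group T lab l = {\<sigma> \<in> Q_tilde T lab l.
     tree_sgn T lab l \<sigma> (tree_root T) * tree_sgn T lab (l - 1) \<sigma> (tree_root T) = 1}"


section \<open>Polynomial dynamics over the algebraic closure\<close>

text \<open>
  The base field is the type \<open>'a\<close>, embedded by \<^const>\<open>to_ac\<close> into its algebraic closure.
\<close>
definition ac_map :: "'a::field poly \<Rightarrow> 'a alg_closure \<Rightarrow> 'a alg_closure" where
  "ac_map f = poly (map_poly to_ac f)"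

definition critical_points :: "'a::field poly \<Rightarrow> 'a alg_closure set" where
  "critical_points f = {z. poly (pderiv (map_poly to_ac f)) z = 0}"

definition periodic :: "('b \<Rightarrow> 'b) \<Rightarrow> 'b \<Rightarrow> bool" where
  "periodic g x \<longleftrightarrow> (\<exists>n\<ge>1. (g ^^ n) x = x)"

definition iter_preimage :: "'a::field poly \<Rightarrow> 'a \<Rightarrow> nat \<Rightarrow> 'a alg_closure set" where
  "iter_preimage f x\<^sub>0 n = {y. (ac_map f ^^ n) y = to_ac x\<^sub>0}"

text \<open>
  The nodes form the disjoint union of the sets \<^term>\<open>iter_preimage f x\<^sub>0 n\<close>: a node at
  level \<open>n\<close> is a pair \<open>(n, y)\<close>.
\<close>
definition backward_orbit_tree ::
    "'a::field poly \<Rightarrow> 'a \<Rightarrow> (nat \<times> 'a alg_closure) rooted_tree" where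
  "backward_orbit_tree f x\<^sub>0 =
     \<lparr>tree_nodes = (SIGMA n:UNIV. iter_preimage f x\<^sub>0 n),
      tree_root = (0, to_ac x\<^sub>0),
      tree_level = fst,
      tree_parent = (\<lambda>(n, y). (n - 1, ac_map f y))\<rparr>"


section \<open>Arboreal Galois groups\<close>

definition preimage_field :: "'a::field poly \<Rightarrow> 'a \<Rightarrow> nat \<Rightarrow> 'a alg_closure set" where
  "preimage_field f x\<^sub>0 n =
     generate_field ring_of_type_algebra (range to_ac \<union> iter_preimage f x\<^sub>0 n)"

definition preimage_field_inf :: "'a::field poly \<Rightarrow> 'a \<Rightarrow> 'a alg_closure set" where
  "preimage_field_inf f x\<^sub>0 = (\<Union>n. preimage_field f x\<^sub>0 n)"

definition galois_group :: "'b::field set \<Rightarrow> 'b set \<Rightarrow> ('b \<Rightarrow> 'b) set" where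
  "galois_group L K = {\<sigma> \<in> Bij L \<inter>
       ring_hom (ring_of_type_algebra\<lparr>carrier := L\<rparr>) (ring_of_type_algebra\<lparr>carrier := L\<rparr>).
     \<forall>x\<in>K. \<sigma> x = x}"

definition arboreal_galois_group ::
    "'a::field poly \<Rightarrow> 'a \<Rightarrow> ('a alg_closure \<Rightarrow> 'a alg_closure) set" where
  "arboreal_galois_group f x\<^sub>0 = galois_group (preimage_field_inf f x\<^sub>0) (range to_ac)"

definition arboreal_action ::
    "'a::field poly \<Rightarrow> 'a \<Rightarrow> ('a alg_closure \<Rightarrow> 'a alg_closure) \<Rightarrow>
     nat \<times> 'a alg_closure \<Rightarrow> nat \<times> 'a alg_closure" where
  "arboreal_action f x\<^sub>0 \<sigma> =
     restrict (\<lambda>(n, y). (n, \<sigma> y)) (tree_nodes (backward_orbit_tree f x\<^sub>0))"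

end

theory Submission
  imports Defs "HOL-Library.List_Lexorder"
begin

text \<open>
  For a node \<open>y\<close> let \<open>V\<^sub>m(y)\<close> be the Vandermonde product of the roots of \<open>f\<^sup>m(z) = y\<close>, ordered by their
  labels. A Galois element \<open>\<sigma>\<close> sends \<open>V\<^sub>m(y)\<close> to \<open>sgn\<^sub>m(\<sigma>, y) V\<^sub>m(\<sigma> y)\<close>. The discriminant of \<open>f\<^sup>m(z) - y\<close>
  is, up to constants, a product of values of \<open>f'\<close>, hence of the numbers \<open>f\<^sup>k(\<gamma>\<^sub>i) - y\<close> for \<open>k \<le> m\<close>. Passing
  from \<open>m = l - 1\<close> to \<open>m = l\<close> multiplies it, up to squares, by \<open>-3 (f\<^sup>l(\<gamma>\<^sub>1) - y) (f\<^sup>l(\<gamma>\<^sub>2) - y)\<close>, which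
  the collision turns into \<open>-3\<close> times a square. So \<open>V\<^sub>l(y) V\<^sub>l\<^sub>-\<^sub>1(y) = \<plusminus> s r(y)\<close> with \<open>s\<^sup>2 = -3\<close> and \<open>r(y)\<close>
  rational in \<open>y\<close> over \<open>K\<close>. Transposing two sibling labels \<open>l\<close> levels above \<open>y\<close> flips this sign, so
  the labeling can be chosen such that it is always \<open>+\<close>; then
  \<open>sgn\<^sub>l(\<sigma>, y) sgn\<^sub>l\<^sub>-\<^sub>1(\<sigma>, y) = \<sigma>(s) / s\<close> for all \<open>y\<close>. Conversely, for any labeling this equation holds at
  the root, and if \<open>s\<close> is not in \<open>K\<close> some Galois element moves it.
\<close>

section \<open>Vandermonde products\<close>

text \<open>A single discriminant contains all the factors \<open>f^k(\<gamma>_i) - y\<close> with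
  \<open>k \<le> m\<close>. The product of two consecutive levels isolates the last pair: each point
  of level \<open>l - 1\<close> has three preimages, so up to constants the discriminant of level
  \<open>l - 1\<close> enters that of level \<open>l\<close> as a cube, and the product contains its
  fourth power. The 3 in \<open>-3\<close> is what differentiation puts in front of the leading
  coefficient of \<open>f\<close>, raised to an odd power; that leading coefficient itself cancels
  up to squares. The minus sign comes from the parity of the numbers of pairs of roots. A swap made
  for the sake of \<open>y\<close> also changes the products at nodes farther from the root, so the
  signs cannot be corrected independently: they are corrected by increasing level, and the labeling
  is the limit of the corrections. For the converse, \<open>s\<close> is not known in advance to lie
  in \<open>K_inf\<close>. The conjugation of \<open>K(s)\<close> is therefore extended to the whole
  algebraic closure and only then restricted; finiteness of the fibers makes the restriction
  bijective.\<close>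

definition vandermonde :: "('i::linorder \<Rightarrow> 'b::comm_ring_1) \<Rightarrow> 'i set \<Rightarrow> 'b" where
  "vandermonde g A = (\<Prod>j\<in>A. \<Prod>i\<in>{i\<in>A. i < j}. g j - g i)"

lemma vandermonde_cong:
  "(\<And>i. i \<in> A \<Longrightarrow> g i = h i) \<Longrightarrow> vandermonde g A = vandermonde h A"
  unfolding vandermonde_def by (intro prod.cong refl) auto

text \<open>The new index need not be the largest, hence a sign for each larger index. This freedom
  allows any two chosen indices to be peeled off.\<close>

lemma vandermonde_insert:
  assumes "finite A" "x \<notin> A"
  shows "vandermonde g (insert x A) =
    (\<Prod>c\<in>A. (if x < c then -1 else 1) * (g x - g c)) * vandermonde g A"
proof -
  have 1: "{i \<in> insert x A. i < x} = {i\<in>A. i < x}" by auto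
  have 2: "(\<Prod>i\<in>{i\<in>insert x A. i < j}. g j - g i) =
      (if x < j then g j - g x else 1) * (\<Prod>i\<in>{i\<in>A. i < j}. g j - g i)" if "j \<in> A" for j
  proof -
    have "{i\<in>insert x A. i < j} = (if x < j then insert x {i\<in>A. i < j} else {i\<in>A. i < j})"
      by auto
    then show ?thesis using assms by simp
  qed
  have "vandermonde g (insert x A) = (\<Prod>i\<in>{i\<in>A. i < x}. g x - g i) *
      (\<Prod>j\<in>A. (if x < j then g j - g x else 1) * (\<Prod>i\<in>{i\<in>A. i < j}. g j - g i))"
    unfolding vandermonde_def prod.insert[OF assms] 1 by (simp only: 2 cong: prod.cong)
  also have "(\<Prod>i\<in>{i\<in>A. i < x}. g x - g i) = (\<Prod>i\<in>A. if i < x then g x - g i else 1)"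
    using assms by (simp add: prod.inter_filter)
  also have "\<dots> * (\<Prod>j\<in>A. (if x < j then g j - g x else 1) * (\<Prod>i\<in>{i\<in>A. i < j}. g j - g i)) =
     (\<Prod>i\<in>A. (if i < x then g x - g i else 1) * (if x < i then g i - g x else 1)) * vandermonde g A"
    by (simp add: vandermonde_def prod.distrib mult_ac)
  also have "(\<Prod>i\<in>A. (if i < x then g x - g i else 1) * (if x < i then g i - g x else 1)) =
     (\<Prod>c\<in>A. (if x < c then -1 else 1) * (g x - g c))"
    using assms by (intro prod.cong refl) auto
  finally show ?thesis .
qed

text \<open>Peel off \<open>a\<close> and \<open>b\<close>. The order signs against the remaining
  indices do not depend on \<open>g\<close>, the two products of differences with those indices
  merely change places, and only the factor between \<open>g a\<close> and \<open>g b\<close>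
  changes sign.\<close>

lemma vandermonde_transpose:
  assumes "finite A" "a \<in> A" "b \<in> A" "a \<noteq> b"
  shows "vandermonde (\<lambda>i. g (transpose a b i)) A = - vandermonde g A"
proof -
  define B where "B = A - {a, b}"
  have A: "A = insert a (insert b B)" and B: "a \<notin> insert b B" "b \<notin> B" "finite B" "a \<notin> B"
    using assms by (auto simp: B_def)
  have "vandermonde (\<lambda>i. g (transpose a b i)) B = vandermonde g B"
    by (rule vandermonde_cong) (auto simp: B_def transpose_def)
  moreover have "(\<Prod>c\<in>B. (if x < c then -1 else 1) * (y - g (transpose a b c))) =
      (\<Prod>c\<in>B. if x < c then -1 else 1) * (\<Prod>c\<in>B. y - g c)" for x y
    unfolding prod.distrib[symmetric] by (rule prod.cong) (auto simp: B_def transpose_def)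
  moreover have "(\<Prod>c\<in>B. (if x < c then -1 else 1) * (y - g c)) =
      (\<Prod>c\<in>B. if x < c then -1 else 1) * (\<Prod>c\<in>B. y - g c)" for x y
    unfolding prod.distrib[symmetric] ..
  ultimately show ?thesis using B assms(4)
    unfolding A by (simp add: vandermonde_insert algebra_simps)
qed

lemma vandermonde_permute:
  assumes "finite A" "p permutes A"
  shows "vandermonde (\<lambda>i. g (p i)) A = of_int (sign p) * vandermonde g A"
  using assms(2,1)
proof (induction arbitrary: g rule: permutes_induct)
  case (swap a b p)
  have "vandermonde (\<lambda>i. g ((transpose a b \<circ> p) i)) A =
      of_int (sign p) * vandermonde (\<lambda>i. g (transpose a b i)) A"
    using swap.IH[of "\<lambda>i. g (transpose a b i)"] assms(1) by simp
  also have "sign (transpose a b \<circ> p) = - sign p"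
    using swap assms(1)
    using permutation_permutes
    by (subst sign_compose) (auto simp: sign_swap_id permutation_swap_id)
  ultimately show ?case
    unfolding o_def using swap assms(1) by (simp add: vandermonde_transpose)
qed (use assms in auto)

text \<open>Each unordered pair occurs twice on the right, with opposite differences, and so costs
  one sign.\<close>

lemma vandermonde_square:
  assumes "finite A"
  shows "(vandermonde g A)\<^sup>2 = (-1) ^ (card A choose 2) * (\<Prod>i\<in>A. \<Prod>j\<in>A - {i}. g i - g j)"
  using assms
proof (induction)
  case (insert x A)
  have 1: "(\<Prod>j\<in>insert x A - {i}. g i - g j) = - (g x - g i) * (\<Prod>j\<in>A - {i}. g i - g j)"
    if "i \<in> A" for i
  proof -
    have "insert x A - {i} = insert x (A - {i})" using insert that by auto
    then show ?thesis using insert by simp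
  qed
  have 2: "insert x A - {x} = A" using insert by auto
  have 3: "(Suc n choose 2) = n + (n choose 2)" for n
    by (simp add: numeral_2_eq_2)
  have 4: "(\<Prod>c\<in>A. (if x < c then - 1 else 1) * (g x - g c))\<^sup>2 = (\<Prod>c\<in>A. g x - g c)\<^sup>2"
    unfolding prod_power_distrib by (rule prod.cong) (auto simp: power2_eq_square algebra_simps)
  have 5: "(\<Prod>i\<in>A. - (g x - g i) * (\<Prod>j\<in>A - {i}. g i - g j)) =
    (-1) ^ card A * (\<Prod>i\<in>A. g x - g i) * (\<Prod>i\<in>A. \<Prod>j\<in>A - {i}. g i - g j)"
    unfolding prod.distrib prod_uminus by simp
  have "(\<Prod>i\<in>insert x A. \<Prod>j\<in>insert x A - {i}. g i - g j) =
     (\<Prod>i\<in>A. g x - g i) * (\<Prod>i\<in>A. - (g x - g i) * (\<Prod>j\<in>A - {i}. g i - g j))"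
    using insert 1 by (simp add: 2)
  then have 6: "(\<Prod>i\<in>insert x A. \<Prod>j\<in>insert x A - {i}. g i - g j) =
      (-1) ^ card A * ((\<Prod>i\<in>A. g x - g i)\<^sup>2 * (\<Prod>i\<in>A. \<Prod>j\<in>A - {i}. g i - g j))"
    unfolding 5 by (simp only: power2_eq_square mult_ac)
  have 7: "(-1) ^ (Suc (card A) choose 2) * (-1) ^ card A = ((-1) ^ (card A choose 2) :: 'b)"
    by (simp add: 3 flip: power_add) (simp add: power_add mult_ac flip: power_mult_distrib)
  have 8: "(vandermonde g (insert x A))\<^sup>2 = (\<Prod>i\<in>A. g x - g i)\<^sup>2 * (vandermonde g A)\<^sup>2"
    by (simp only: vandermonde_insert[OF insert(1,2)] power_mult_distrib 4)
  have 9: "card (insert x A) = Suc (card A)" using insert by simp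
  show ?case
    unfolding 6 8 9 insert.IH 7[symmetric] by (simp only: ac_simps)
qed (simp add: vandermonde_def binomial_eq_0)

lemma vandermonde_nonzero:
  fixes g :: "'i::linorder \<Rightarrow> 'b::idom"
  assumes "finite A" "inj_on g A"
  shows "vandermonde g A \<noteq> 0"
  using assms unfolding vandermonde_def by (auto simp: inj_on_def)

section \<open>Discriminants of iterated cubics\<close>

lemma poly_eq_prod_roots:
  fixes p :: "'b::field poly"
  assumes "card {x. poly p x = 0} = Polynomial.degree p" "p \<noteq> 0"
  shows "p = Polynomial.smult (Polynomial.lead_coeff p) (\<Prod>x\<in>{x. poly p x = 0}. [:-x, 1:])"
proof (rule poly_eqI_degree_lead_coeff)
  let ?S = "{x. poly p x = 0}" and ?q = "\<Prod>x\<in>{x. poly p x = 0}. [:-x, 1:]"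
  have fin: "finite ?S" using assms(2) by (rule poly_roots_finite)
  have deg: "Polynomial.degree ?q = Polynomial.degree p"
    using assms(1) by (subst degree_prod_eq_sum_degree) auto
  have "Polynomial.lead_coeff ?q = 1" by (simp add: lead_coeff_prod)
  then show "Polynomial.coeff p (Polynomial.degree p) =
      Polynomial.coeff (Polynomial.smult (Polynomial.lead_coeff p) ?q) (Polynomial.degree p)"
    by (simp add: deg)
  show "card ?S \<ge> Polynomial.degree p" using assms by simp
  show "Polynomial.degree (Polynomial.smult (Polynomial.lead_coeff p) ?q) \<le> Polynomial.degree p"
    using deg by simp
  show "poly p z = poly (Polynomial.smult (Polynomial.lead_coeff p) ?q) z" if "z \<in> ?S" for z
    using that fin by (auto simp: poly_prod)
qed simp

text \<open>A repeated linear factor in the splitting of \<open>p\<close> would give a common root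
  of \<open>p\<close> and its derivative, so the multiset of roots is a set.\<close>

lemma card_roots_separable:
  fixes p :: "'b::alg_closed_field poly"
  assumes "p \<noteq> 0" "\<And>x. poly p x = 0 \<Longrightarrow> poly (pderiv p) x \<noteq> 0"
  shows "card {x. poly p x = 0} = Polynomial.degree p"
proof -
  obtain A where A: "size A = Polynomial.degree p"
    "p = Polynomial.smult (Polynomial.lead_coeff p) (\<Prod>x\<in>#A. [:-x, 1:])"
    using alg_closed_imp_factorization[OF assms(1)] by blast
  have root: "x \<in># A \<Longrightarrow> poly p x = 0" for x
    by (subst A(2)) (auto simp: poly_prod_mset image_iff)
  have root': "x \<in># A" if "poly p x = 0" for x
    using that assms(1) by (subst (asm) A(2)) (auto simp: poly_prod_mset image_iff)
  have "count A x \<le> 1" for x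
  proof (rule ccontr)
    assume "\<not> count A x \<le> 1"
    then have "x \<in># A" "x \<in># A - {#x#}"
      by (auto simp: in_diff_count intro: count_inI)
    then obtain B where B: "A = add_mset x (add_mset x B)"
      by (metis mset_add insert_DiffM)
    define q where "q = Polynomial.smult (Polynomial.lead_coeff p) (\<Prod>x\<in>#B. [:-x, 1:])"
    have q: "p = [:-x, 1:] * ([:-x, 1:] * q)"
      by (subst A(2)) (simp add: B q_def)
    have "poly (pderiv p) x = 0"
      unfolding q by (simp add: pderiv_mult del: mult_pCons_left mult_pCons_right)
    with assms(2) root[OF \<open>x \<in># A\<close>] show False by blast
  qed
  then have "A = mset_set (set_mset A)"
    by (intro multiset_eqI, subst count_mset_set')
       (simp, metis One_nat_def count_greater_eq_one_iff le_antisym not_in_iff)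
  moreover have "set_mset A = {x. poly p x = 0}" using root root' by auto
  ultimately show ?thesis using A(1) by (metis size_mset_set)
qed

section \<open>Iterates of a cubic, their fibers and the multipliers of the fibers\<close>

primrec iter_poly :: "'b::comm_ring_1 poly \<Rightarrow> nat \<Rightarrow> 'b poly" where
  "iter_poly F 0 = [:0, 1:]"
| "iter_poly F (Suc n) = pcompose F (iter_poly F n)"

lemma poly_iter_poly: "poly (iter_poly F n) x = (poly F ^^ n) x"
  by (induction n) (auto simp: poly_pcompose)

lemma pderiv_iter_poly:
  "poly (pderiv (iter_poly F n)) x = (\<Prod>i<n. poly (pderiv F) ((poly F ^^ i) x))"
  by (induction n)
     (auto simp: pderiv_pcompose pderiv_pCons poly_pcompose poly_iter_poly mult_ac)

lemma degree_iter_poly: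
  "Polynomial.degree (iter_poly F n) = Polynomial.degree F ^ n" for F :: "'b::idom poly"
  by (induction n) (auto simp: degree_pcompose)

lemma poly_pderiv_root:
  fixes p :: "'b::field poly"
  assumes "card {x. poly p x = 0} = Polynomial.degree p" "p \<noteq> 0" "poly p w = 0"
  shows "poly (pderiv p) w = Polynomial.lead_coeff p * (\<Prod>x\<in>{x. poly p x = 0} - {w}. w - x)"
proof -
  let ?S = "{x. poly p x = 0}"
  have fin: "finite ?S" using assms(2) by (rule poly_roots_finite)
  define r where "r = Polynomial.smult (Polynomial.lead_coeff p) (\<Prod>x\<in>?S - {w}. [:-x, 1:])"
  have "p = [:-w, 1:] * r"
    unfolding r_def by (subst poly_eq_prod_roots[OF assms(1,2)]) (simp add: prod.remove[OF fin, of w] assms(3))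
  then have "poly (pderiv p) w = poly r w"
    by (simp add: pderiv_mult pderiv_pCons del: mult_pCons_left mult_pCons_right)
  then show ?thesis by (simp add: r_def poly_prod)
qed

text \<open>The discriminant as the resultant of \<open>p\<close> and its derivative: the derivative
  at a root is the leading coefficient times the product of the differences to the other roots.
  Keeping the leading coefficients on the left avoids division.\<close>

lemma vandermonde_roots_square:
  fixes p :: "'b::field poly"
  assumes "bij_betw g A {x. poly p x = 0}" "finite A" "p \<noteq> 0" "card A = Polynomial.degree p"
  shows "Polynomial.lead_coeff p ^ card A * (vandermonde g A)\<^sup>2 =
    (-1) ^ (card A choose 2) * (\<Prod>w\<in>{x. poly p x = 0}. poly (pderiv p) w)"
proof -
  let ?S = "{x. poly p x = 0}"
  have card: "card ?S = Polynomial.degree p"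
    using assms bij_betw_same_card by metis
  have 1: "(\<Prod>j\<in>A - {i}. g i - g j) = (\<Prod>x\<in>?S - {g i}. g i - x)" if "i \<in> A" for i
  proof -
    have "bij_betw g (A - {i}) (?S - {g i})"
      using assms(1) that by (auto simp: bij_betw_def inj_on_def)
    then show ?thesis by (rule prod.reindex_bij_betw)
  qed
  have "(\<Prod>w\<in>?S. poly (pderiv p) w) = (\<Prod>i\<in>A. poly (pderiv p) (g i))"
    by (rule prod.reindex_bij_betw[OF assms(1), symmetric])
  also have "\<dots> = (\<Prod>i\<in>A. Polynomial.lead_coeff p * (\<Prod>j\<in>A - {i}. g i - g j))"
  proof (rule prod.cong)
    fix i assume i: "i \<in> A"
    then have "poly p (g i) = 0" using assms(1) by (auto simp: bij_betw_def)
    then show "poly (pderiv p) (g i) = Polynomial.lead_coeff p * (\<Prod>j\<in>A - {i}. g i - g j)"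
      by (simp add: poly_pderiv_root[OF card assms(3)] 1[OF i])
  qed simp
  also have "\<dots> = Polynomial.lead_coeff p ^ card A * (\<Prod>i\<in>A. \<Prod>j\<in>A - {i}. g i - g j)"
    by (simp add: prod.distrib)
  finally show ?thesis
    by (simp add: vandermonde_square[OF assms(2)] mult.left_commute)
qed

lemma finite_ternary_words [simp]: "finite (ternary_words m)"
  and card_ternary_words: "card (ternary_words m) = 3 ^ m"
proof -
  have eq: "ternary_words m = {w. set w \<subseteq> {0, 1, 2} \<and> length w = m}"
    by (auto simp: ternary_words_def)
  show "finite (ternary_words m)" unfolding eq by (rule finite_lists_length_eq) simp
  show "card (ternary_words m) = 3 ^ m"
    unfolding eq by (subst card_lists_length_eq) (auto simp: eval_nat_numeral)
qed

definition fiber :: "('b \<Rightarrow> 'b) \<Rightarrow> nat \<Rightarrow> 'b \<Rightarrow> 'b set" where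
  "fiber g k u = {w. (g ^^ k) w = u}"

text \<open>The hypothesis on the base point, transferred to arbitrary points: it passes to the
  whole backward orbit and makes every fiber separable.\<close>

definition uncritical :: "'b::field poly \<Rightarrow> 'b \<Rightarrow> bool" where
  "uncritical F u \<longleftrightarrow> (\<forall>k. \<forall>w\<in>fiber (poly F) k u. poly (pderiv F) w \<noteq> 0)"

text \<open>By the chain rule this is the product, over the fiber, of the derivative of the
  \<open>k\<close>-th iterate; hence it is the discriminant of \<open>iter_poly F k - [:u:]\<close>
  up to sign and leading coefficients.\<close>

definition fiber_multiplier :: "'b::field poly \<Rightarrow> nat \<Rightarrow> 'b \<Rightarrow> 'b" where
  "fiber_multiplier F k u =
    (\<Prod>w\<in>fiber (poly F) k u. \<Prod>i<k. poly (pderiv F) ((poly F ^^ i) w))"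

lemma uncritical_fiber:
  "uncritical F u \<Longrightarrow> v \<in> fiber (poly F) k u \<Longrightarrow> uncritical F v"
  unfolding uncritical_def fiber_def by (simp, metis comp_apply funpow_add)

lemma fiber_eq_roots:
  "fiber (poly F) k u = {w. poly (iter_poly F k - [:u:]) w = 0}"
  by (auto simp: fiber_def poly_iter_poly)

lemma
  fixes F :: "'b::field poly"
  assumes "Polynomial.degree F = 3"
  shows degree_fiber_poly: "Polynomial.degree (iter_poly F k - [:u:]) = 3 ^ k"
    and lead_coeff_fiber_poly:
      "Polynomial.lead_coeff (iter_poly F k - [:u:]) = Polynomial.lead_coeff (iter_poly F k)"
proof -
  have "Polynomial.degree [:u:] < Polynomial.degree (iter_poly F k)"
    using assms by (simp add: degree_iter_poly)
  then have deg: "Polynomial.degree (iter_poly F k - [:u:]) = Polynomial.degree (iter_poly F k)"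
    by (metis degree_add_eq_left degree_minus diff_conv_add_uminus)
  then show "Polynomial.degree (iter_poly F k - [:u:]) = 3 ^ k"
    using assms by (simp add: degree_iter_poly)
  show "Polynomial.lead_coeff (iter_poly F k - [:u:]) = Polynomial.lead_coeff (iter_poly F k)"
    unfolding deg using assms by (simp add: degree_iter_poly coeff_eq_0)
qed

lemma fiber_poly_nonzero:
  fixes F :: "'b::field poly"
  assumes "Polynomial.degree F = 3"
  shows "iter_poly F k - [:u:] \<noteq> 0"
proof
  assume "iter_poly F k - [:u:] = 0"
  then have "3 ^ k = (0::nat)" using degree_fiber_poly[OF assms, of k u] by simp
  then show False by simp
qed

lemma finite_fiber:
  fixes F :: "'b::field poly"
  assumes "Polynomial.degree F = 3"
  shows "finite (fiber (poly F) k u)"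
  unfolding fiber_eq_roots by (rule poly_roots_finite[OF fiber_poly_nonzero[OF assms]])

lemma lead_coeff_iter_poly_Suc:
  fixes F :: "'b::field poly"
  assumes "Polynomial.degree F = 3"
  shows "Polynomial.lead_coeff (iter_poly F (Suc k)) =
    Polynomial.lead_coeff F * Polynomial.lead_coeff (iter_poly F k) ^ 3"
  using assms by (simp only: iter_poly.simps) (subst lead_coeff_comp, auto simp: degree_iter_poly)

lemma pderiv_fiber_poly:
  fixes F :: "'b::field poly"
  shows "poly (pderiv (iter_poly F k - [:u:])) w = (\<Prod>i<k. poly (pderiv F) ((poly F ^^ i) w))"
  by (simp add: pderiv_diff pderiv_pCons pderiv_iter_poly)

text \<open>Until it reaches \<open>u\<close>, the orbit of a fiber point runs through fibers over
  \<open>u\<close>, so no factor of the chain rule vanishes and all roots are simple.\<close>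

lemma card_fiber:
  fixes F :: "'b::alg_closed_field poly"
  assumes "Polynomial.degree F = 3" "uncritical F u"
  shows "card (fiber (poly F) k u) = 3 ^ k"
proof -
  have "card {w. poly (iter_poly F k - [:u:]) w = 0} = Polynomial.degree (iter_poly F k - [:u:])"
  proof (rule card_roots_separable[OF fiber_poly_nonzero[OF assms(1)]])
    fix w assume "poly (iter_poly F k - [:u:]) w = 0"
    then have w: "(poly F ^^ k) w = u" by (simp add: poly_iter_poly)
    have "poly (pderiv F) ((poly F ^^ i) w) \<noteq> 0" if "i < k" for i
    proof -
      have "(poly F ^^ (k - i)) ((poly F ^^ i) w) = u"
        using w that by (metis comp_apply funpow_add le_add_diff_inverse2 less_imp_le)
      then show ?thesis using assms(2) by (auto simp: uncritical_def fiber_def)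
    qed
    then show "poly (pderiv (iter_poly F k - [:u:])) w \<noteq> 0"
      by (simp add: pderiv_fiber_poly)
  qed
  then show ?thesis
    by (simp add: fiber_eq_roots degree_fiber_poly[OF assms(1)] del: poly_diff)
qed

lemma vandermonde_fiber_square:
  fixes F :: "'b::field poly"
  assumes "Polynomial.degree F = 3" "bij_betw g (ternary_words k) (fiber (poly F) k u)"
  shows "Polynomial.lead_coeff (iter_poly F k) ^ 3 ^ k * (vandermonde g (ternary_words k))\<^sup>2 =
    (-1) ^ (3 ^ k choose 2) * fiber_multiplier F k u"
  using vandermonde_roots_square[OF assms(2)[unfolded fiber_eq_roots]]
    fiber_poly_nonzero[OF assms(1), of k u]
  unfolding lead_coeff_fiber_poly[OF assms(1)]
  unfolding degree_fiber_poly[OF assms(1)] card_ternary_words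
    pderiv_fiber_poly fiber_eq_roots[symmetric] fiber_multiplier_def
  by simp

text \<open>The factor for \<open>i = 0\<close> gives the product of the derivatives. The other
  factors depend only on \<open>poly F w\<close>, and every point of the level \<open>k\<close>
  fiber has three preimages, whence the cube.\<close>

lemma fiber_multiplier_Suc:
  fixes F :: "'b::alg_closed_field poly"
  assumes "Polynomial.degree F = 3" "uncritical F u"
  shows "fiber_multiplier F (Suc k) u =
    (\<Prod>w\<in>fiber (poly F) (Suc k) u. poly (pderiv F) w) * fiber_multiplier F k u ^ 3"
proof -
  let ?S = "fiber (poly F) (Suc k) u" and ?T = "fiber (poly F) k u"
  let ?h = "\<lambda>w. \<Prod>i<k. poly (pderiv F) ((poly F ^^ i) w)"
  have "(\<Prod>w\<in>?S. ?h (poly F w)) = (\<Prod>v\<in>?T. \<Prod>w\<in>{w\<in>?S. poly F w = v}. ?h (poly F w))"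
    by (rule prod.group[symmetric])
       (auto simp: finite_fiber[OF assms(1)], auto simp: fiber_def funpow_swap1)
  also have "\<dots> = (\<Prod>v\<in>?T. ?h v ^ 3)"
  proof (rule prod.cong)
    fix v assume v: "v \<in> ?T"
    then have "{w\<in>?S. poly F w = v} = fiber (poly F) 1 v"
      by (auto simp: fiber_def funpow_swap1)
    then have "card {w\<in>?S. poly F w = v} = 3"
      using card_fiber[OF assms(1) uncritical_fiber[OF assms(2) v], of 1] by simp
    moreover have "(\<Prod>w\<in>{w\<in>?S. poly F w = v}. ?h (poly F w)) = (\<Prod>w\<in>{w\<in>?S. poly F w = v}. ?h v)"
      by (rule prod.cong) auto
    ultimately show "(\<Prod>w\<in>{w\<in>?S. poly F w = v}. ?h (poly F w)) = ?h v ^ 3"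
      by (simp only: prod_constant)
  qed simp
  finally show ?thesis
    by (simp add: fiber_multiplier_def prod.lessThan_Suc_shift prod.distrib funpow_swap1
        prod_power_distrib del: prod.lessThan_Suc)
qed

text \<open>This evaluates the factorization of \<open>iter_poly F k - [:u:]\<close> at
  \<open>z\<close>. At the collision level the right-hand side becomes \<open>c - u\<close> for both
  critical points alike.\<close>

lemma prod_fiber_linear:
  fixes F :: "'b::alg_closed_field poly"
  assumes "Polynomial.degree F = 3" "uncritical F u"
  shows "Polynomial.lead_coeff (iter_poly F k) * (\<Prod>w\<in>fiber (poly F) k u. z - w) = (poly F ^^ k) z - u"
proof -
  let ?p = "iter_poly F k - [:u:]"
  have "?p = Polynomial.smult (Polynomial.lead_coeff ?p) (\<Prod>x\<in>{x. poly ?p x = 0}. [:-x, 1:])"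
    by (rule poly_eq_prod_roots[OF _ fiber_poly_nonzero[OF assms(1)]])
       (use card_fiber[OF assms] in \<open>simp add: fiber_eq_roots degree_fiber_poly[OF assms(1)] del: poly_diff\<close>)
  then have "poly ?p z =
      poly (Polynomial.smult (Polynomial.lead_coeff (iter_poly F k)) (\<Prod>x\<in>fiber (poly F) k u. [:-x, 1:])) z"
    unfolding fiber_eq_roots lead_coeff_fiber_poly[OF assms(1)] by (rule arg_cong)
  then show ?thesis by (simp add: poly_prod poly_iter_poly)
qed

text \<open>The \<open>r(u)\<close> of the introduction, for \<open>m = l - 1\<close>.\<close>

definition level_ratio :: "'b::field poly \<Rightarrow> nat \<Rightarrow> 'b \<Rightarrow> 'b \<Rightarrow> 'b" where
  "level_ratio F m c u =
    3 ^ ((3 ^ Suc m - 1) div 2) * (c - u) * (fiber_multiplier F m u)\<^sup>2 /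
    (Polynomial.lead_coeff (iter_poly F m) ^ (5 * 3 ^ m) * Polynomial.lead_coeff (iter_poly F (Suc m)))"

text \<open>Up to sign and leading coefficients the left-hand side is \<open>E * D ^ 4\<close>. The
  collision turns \<open>B\<^sup>2 * E\<close> into \<open>(3 * a) ^ (3 * n)\<close> times a square;
  as the power of \<open>a\<close> cancels, only one factor 3 and a sign remain outside the
  squares.\<close>

lemma vandermonde_two_levels_square:
  fixes F :: "'b::alg_closed_field poly"
  assumes deg: "Polynomial.degree F = 3" and u: "uncritical F u"
    and F': "pderiv F = Polynomial.smult (3 * Polynomial.lead_coeff F) ([:-\<gamma>\<^sub>1, 1:] * [:-\<gamma>\<^sub>2, 1:])"
    and c: "(poly F ^^ Suc m) \<gamma>\<^sub>1 = c" "(poly F ^^ Suc m) \<gamma>\<^sub>2 = c"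
    and g: "bij_betw g (ternary_words (Suc m)) (fiber (poly F) (Suc m) u)"
    and h: "bij_betw h (ternary_words m) (fiber (poly F) m u)"
  shows "(vandermonde g (ternary_words (Suc m)) * vandermonde h (ternary_words m))\<^sup>2 =
    -3 * (level_ratio F m c u)\<^sup>2"
proof -
  define a where "a = Polynomial.lead_coeff F"
  define A where "A = Polynomial.lead_coeff (iter_poly F m)"
  define B where "B = Polynomial.lead_coeff (iter_poly F (Suc m))"
  define V where "V = vandermonde g (ternary_words (Suc m))"
  define V' where "V' = vandermonde h (ternary_words m)"
  define D where "D = fiber_multiplier F m u"
  define E where "E = (\<Prod>w\<in>fiber (poly F) (Suc m) u. poly (pderiv F) w)"
  define n :: nat where "n = 3 ^ m"
  have n: "3 ^ Suc m = 3 * n" "odd n" by (auto simp: n_def)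
  have "F \<noteq> 0" using deg by auto
  then have "a \<noteq> 0" by (simp add: a_def)
  have "A \<noteq> 0" "B \<noteq> 0"
    using fiber_poly_nonzero[OF deg, of m 0] fiber_poly_nonzero[OF deg, of "Suc m" 0]
    by (auto simp: A_def B_def simp del: iter_poly.simps)
  have B: "B = a * A ^ 3"
    unfolding a_def A_def B_def by (rule lead_coeff_iter_poly_Suc[OF deg])
  have 1: "B ^ (3 * n) * V\<^sup>2 = (-1) ^ (3 * n choose 2) * (E * D ^ 3)"
    using vandermonde_fiber_square[OF deg g]
    unfolding fiber_multiplier_Suc[OF deg u] n B_def V_def E_def D_def .
  have 2: "A ^ n * V'\<^sup>2 = (-1) ^ (n choose 2) * D"
    using vandermonde_fiber_square[OF deg h] unfolding n_def A_def V'_def D_def .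
  have "poly (pderiv F) w = 3 * a * ((w - \<gamma>\<^sub>1) * (w - \<gamma>\<^sub>2))" for w
    unfolding F' a_def by (simp del: mult_pCons_left mult_pCons_right)
  then have "E = (3 * a) ^ (3 * n) * ((\<Prod>w\<in>fiber (poly F) (Suc m) u. w - \<gamma>\<^sub>1) * (\<Prod>w\<in>fiber (poly F) (Suc m) u. w - \<gamma>\<^sub>2))"
    unfolding E_def
    using card_fiber[OF deg u, of "Suc m"] n(1) by (simp add: prod.distrib power_mult_distrib)
  also have "(\<Prod>w\<in>fiber (poly F) (Suc m) u. w - \<gamma>\<^sub>1) * (\<Prod>w\<in>fiber (poly F) (Suc m) u. w - \<gamma>\<^sub>2) =
     (\<Prod>w\<in>fiber (poly F) (Suc m) u. \<gamma>\<^sub>1 - w) * (\<Prod>w\<in>fiber (poly F) (Suc m) u. \<gamma>\<^sub>2 - w)"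
    unfolding prod.distrib[symmetric] by (rule prod.cong) (auto simp: algebra_simps)
  \<comment> \<open>One factor \<open>B\<close> for each critical point, as
    \<open>prod_fiber_linear\<close> requires.\<close>
  finally have "B\<^sup>2 * E = (3 * a) ^ (3 * n) *
     ((B * (\<Prod>w\<in>fiber (poly F) (Suc m) u. \<gamma>\<^sub>1 - w)) * (B * (\<Prod>w\<in>fiber (poly F) (Suc m) u. \<gamma>\<^sub>2 - w)))"
    by (simp only: power2_eq_square mult_ac)
  then have 3: "B\<^sup>2 * E = (3 * a) ^ (3 * n) * (c - u)\<^sup>2"
    unfolding B_def prod_fiber_linear[OF deg u] c by (simp add: power2_eq_square)
  \<comment> \<open>The sum is \<open>5 * n\<^sup>2 - 2 * n\<close>, which is odd for odd
    \<open>n\<close>; this is the minus sign in \<open>-3\<close>.\<close>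
  have par: "odd ((3 * n choose 2) + (n choose 2))"
  proof -
    obtain j where j: "n = 2 * j + 1" using n(2) oddE by blast
    have "3 * n choose 2 = (6 * j + 3) * (3 * j + 1)"
      unfolding choose_two j by (simp add: algebra_simps)
    moreover have "n choose 2 = (2 * j + 1) * j"
      unfolding choose_two j by (simp add: algebra_simps)
    ultimately show ?thesis by simp
  qed
  have "(B ^ (3 * n) * A ^ n * B\<^sup>2) * (V * V')\<^sup>2 = (B ^ (3 * n) * V\<^sup>2) * (A ^ n * V'\<^sup>2) * B\<^sup>2"
    by (simp only: power_mult_distrib mult_ac)
  also have "\<dots> = (-1) ^ ((3 * n choose 2) + (n choose 2)) * (B\<^sup>2 * E) * D ^ 4"
    unfolding 1 2 by (simp add: power_add eval_nat_numeral mult_ac)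
  also have "\<dots> = - ((3 * a) ^ (3 * n) * (c - u)\<^sup>2 * D ^ 4)"
    unfolding 3 using par by simp
  \<comment> \<open>The exponent \<open>3 * n\<close> is odd, so one 3 is left outside the
    square.\<close>
  also have "(3 * a) ^ (3 * n) = 3 * (3 ^ ((3 * n - 1) div 2))\<^sup>2 * a ^ (3 * n)"
  proof -
    have "3 * n = Suc (2 * ((3 * n - 1) div 2))" using n(2) by presburger
    then have "(3 :: 'b) ^ (3 * n) = 3 * (3 ^ ((3 * n - 1) div 2))\<^sup>2"
      by (metis power_Suc power_even_eq)
    then show ?thesis by (simp add: power_mult_distrib)
  qed
  \<comment> \<open>With \<open>B = a * A ^ 3\<close> the total power of \<open>A\<close> is
    \<open>10 * n\<close>. Its square root is the factor \<open>A ^ (5 * n)\<close> in the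
    denominator of \<open>level_ratio\<close>, and the odd power of \<open>a\<close> cancels against
    the other side.\<close>
  also have "B ^ (3 * n) * A ^ n * B\<^sup>2 = a ^ (3 * n) * (A ^ (5 * n) * B)\<^sup>2"
  proof -
    have "(A ^ 3) ^ (3 * n) * A ^ n = (A ^ (5 * n))\<^sup>2" for A :: 'b
      by (simp flip: power_mult power_add)
    then have "B ^ (3 * n) * A ^ n = a ^ (3 * n) * (A ^ (5 * n))\<^sup>2"
      unfolding B by (simp add: power_mult_distrib flip: power_mult power_add)
    then show ?thesis by (simp add: power_mult_distrib)
  qed
  finally have "a ^ (3 * n) * ((A ^ (5 * n) * B)\<^sup>2 * (V * V')\<^sup>2) =
      a ^ (3 * n) * (-3 * (3 ^ ((3 * n - 1) div 2) * (c - u) * D\<^sup>2)\<^sup>2)"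
    by (simp add: power_mult_distrib mult_ac flip: power_mult)
  then have "(A ^ (5 * n) * B)\<^sup>2 * (V * V')\<^sup>2 = -3 * (3 ^ ((3 * n - 1) div 2) * (c - u) * D\<^sup>2)\<^sup>2"
    using \<open>a \<noteq> 0\<close> mult_cancel_left[of "a ^ (3 * n)"] by fastforce
  moreover have divide_ratio: "y = -3 * (z / x)\<^sup>2" if "x\<^sup>2 * y = -3 * z\<^sup>2" "x \<noteq> 0" for x y z :: 'b
  proof -
    have "x\<^sup>2 * y = x\<^sup>2 * (-3 * (z / x)\<^sup>2)" using that by (simp add: power_divide)
    then show ?thesis using that(2) by (metis mult_cancel_left power_not_zero)
  qed
  moreover have "A ^ (5 * n) * B \<noteq> 0" using \<open>A \<noteq> 0\<close> \<open>B \<noteq> 0\<close> by simp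
  ultimately have "(V * V')\<^sup>2 = -3 * (3 ^ ((3 * n - 1) div 2) * (c - u) * D\<^sup>2 / (A ^ (5 * n) * B))\<^sup>2"
    using divide_ratio by blast
  then show ?thesis
    unfolding level_ratio_def n V_def V'_def A_def B_def D_def n_def[symmetric] .
qed

section \<open>Extension of homomorphisms to the algebraic closure\<close>

text \<open>A homomorphism over \<open>K\<close> on a set closed under sums and products, with its
  image left open. The same lemmas then serve \<open>K_inf\<close> and the whole closure, and the
  identity gives closure properties of a subfield.\<close>

locale base_hom =
  fixes L :: "'a::field alg_closure set" and \<sigma> :: "'a alg_closure \<Rightarrow> 'a alg_closure"
  assumes base_mem: "to_ac a \<in> L"
    and add_mem: "x \<in> L \<Longrightarrow> y \<in> L \<Longrightarrow> x + y \<in> L"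
    and mult_mem: "x \<in> L \<Longrightarrow> y \<in> L \<Longrightarrow> x * y \<in> L"
    and hom_base: "\<sigma> (to_ac a) = to_ac a"
    and hom_add: "x \<in> L \<Longrightarrow> y \<in> L \<Longrightarrow> \<sigma> (x + y) = \<sigma> x + \<sigma> y"
    and hom_mult: "x \<in> L \<Longrightarrow> y \<in> L \<Longrightarrow> \<sigma> (x * y) = \<sigma> x * \<sigma> y"
begin

lemma one_mem: "1 \<in> L" and hom_one: "\<sigma> 1 = 1"
  using base_mem[of 1] hom_base[of 1] by simp_all

lemma diff_mem: "x \<in> L \<Longrightarrow> y \<in> L \<Longrightarrow> x - y \<in> L"
  and hom_diff: "x \<in> L \<Longrightarrow> y \<in> L \<Longrightarrow> \<sigma> (x - y) = \<sigma> x - \<sigma> y"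
proof -
  assume L: "x \<in> L" "y \<in> L"
  \<comment> \<open>Subtraction is expressed through the scalar -1 of \<open>K\<close>, so that the
    locale assumptions on sums and products cover it.\<close>
  have eq: "x - y = x + to_ac (-1) * y" for x y :: "'a alg_closure" by simp
  show "x - y \<in> L" unfolding eq using L by (intro add_mem mult_mem base_mem)
  have "\<sigma> (x + to_ac (-1) * y) = \<sigma> x + to_ac (-1) * \<sigma> y"
    using L by (simp only: hom_add hom_mult hom_base base_mem mult_mem)
  then show "\<sigma> (x - y) = \<sigma> x - \<sigma> y" by simp
qed

lemma prod_mem: "(\<And>i. i \<in> I \<Longrightarrow> g i \<in> L) \<Longrightarrow> prod g I \<in> L"
  by (induction I rule: infinite_finite_induct) (auto simp: one_mem mult_mem)

lemma hom_prod: "(\<And>i. i \<in> I \<Longrightarrow> g i \<in> L) \<Longrightarrow> \<sigma> (prod g I) = (\<Prod>i\<in>I. \<sigma> (g i))"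
  by (induction I rule: infinite_finite_induct) (auto simp: hom_one hom_mult prod_mem)

lemma vandermonde_mem: "(\<And>i. i \<in> I \<Longrightarrow> g i \<in> L) \<Longrightarrow> vandermonde g I \<in> L"
  unfolding vandermonde_def by (auto intro!: prod_mem diff_mem)

lemma hom_vandermonde:
  assumes "\<And>i. i \<in> I \<Longrightarrow> g i \<in> L"
  shows "\<sigma> (vandermonde g I) = vandermonde (\<lambda>i. \<sigma> (g i)) I"
proof -
  have "\<sigma> (\<Prod>i\<in>{i\<in>I. i < j}. g j - g i) = (\<Prod>i\<in>{i\<in>I. i < j}. \<sigma> (g j) - \<sigma> (g i))" if "j \<in> I" for j
    using that assms by (subst hom_prod) (auto simp: hom_diff intro!: diff_mem)
  moreover have "\<sigma> (vandermonde g I) = (\<Prod>j\<in>I. \<sigma> (\<Prod>i\<in>{i\<in>I. i < j}. g j - g i))"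
    unfolding vandermonde_def using assms by (intro hom_prod prod_mem diff_mem) auto
  ultimately show ?thesis by (simp add: vandermonde_def)
qed

lemma poly_mem: "x \<in> L \<Longrightarrow> poly (map_poly to_ac p) x \<in> L"
  by (induction p) (auto simp: map_poly_pCons intro!: add_mem mult_mem base_mem, use base_mem[of 0] in simp)

lemma hom_poly: "x \<in> L \<Longrightarrow> \<sigma> (poly (map_poly to_ac p) x) = poly (map_poly to_ac p) (\<sigma> x)"
proof (induction p)
  case 0
  then show ?case using hom_base[of 0] by simp
next
  case (pCons a p)
  then show ?case by (simp add: map_poly_pCons hom_add hom_mult hom_base base_mem mult_mem poly_mem)
qed

lemma iter_mem: "x \<in> L \<Longrightarrow> (ac_map f ^^ n) x \<in> L"
  by (induction n) (auto simp: ac_map_def poly_mem)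

lemma hom_iter: "x \<in> L \<Longrightarrow> \<sigma> ((ac_map f ^^ n) x) = (ac_map f ^^ n) (\<sigma> x)"
  by (induction n) (use iter_mem in \<open>auto simp: ac_map_def hom_poly\<close>)

end

text \<open>
  Partial homomorphisms are represented by their graphs, so that Zorn's lemma applies to set
  inclusion. Algebraicity makes a functional graph injective as well.
\<close>

locale hom_graph =
  fixes G :: "('a::field alg_closure \<times> 'a alg_closure) set"
  assumes base: "(to_ac a, to_ac a) \<in> G"
    and add: "(x, y) \<in> G \<Longrightarrow> (x', y') \<in> G \<Longrightarrow> (x + x', y + y') \<in> G"
    and mult: "(x, y) \<in> G \<Longrightarrow> (x', y') \<in> G \<Longrightarrow> (x * x', y * y') \<in> G"
    and kernel: "(0, y) \<in> G \<Longrightarrow> y = 0"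
begin

lemma zero: "(0, 0) \<in> G" and one: "(1, 1) \<in> G"
  using base[of 0] base[of 1] by simp_all

lemma diff: "(x, y) \<in> G \<Longrightarrow> (x', y') \<in> G \<Longrightarrow> (x - x', y - y') \<in> G"
  using add[of x y "to_ac (-1) * x'" "to_ac (-1) * y'"] mult[OF base[of "-1"], of x' y'] by simp

lemma sum: "(\<And>i. i \<in> I \<Longrightarrow> (g i, h i) \<in> G) \<Longrightarrow> (sum g I, sum h I) \<in> G"
  by (induction I rule: infinite_finite_induct) (auto simp: zero add)

lemma functional: "(x, y) \<in> G \<Longrightarrow> (x, y') \<in> G \<Longrightarrow> y = y'"
  using kernel[of "y - y'"] diff[of x y x y'] by simp

lemma poly_base: "(x, y) \<in> G \<Longrightarrow> (poly (map_poly to_ac p) x, poly (map_poly to_ac p) y) \<in> G"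
  by (induction p) (auto simp: map_poly_pCons zero intro!: add mult base)

text \<open>A nonzero algebraic \<open>x\<close> is a root of some \<open>q\<close> over
  \<open>K\<close> with nonzero constant term. Applying \<open>q\<close> to the pair
  \<open>(x, 0)\<close> relates 0 to that constant term, against \<open>kernel\<close>.\<close>

lemma injective:
  assumes "(x, 0) \<in> G"
  shows "x = 0"
proof (rule ccontr)
  assume "x \<noteq> 0"
  obtain p :: "'a poly" where p: "p \<noteq> 0" "poly (map_poly to_ac p) x = 0"
    by (rule alg_closure_algebraic)
  have "\<exists>q::'a poly. poly q 0 \<noteq> 0 \<and> poly (map_poly to_ac q) x = 0"
    using p
  proof (induction p)
    case (pCons a p)
    show ?case
    proof (cases "a = 0")
      case True
      then have "poly (map_poly to_ac p) x = 0" "p \<noteq> 0"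
        using pCons \<open>x \<noteq> 0\<close> by (auto simp: map_poly_pCons)
      then show ?thesis using pCons by blast
    next
      case False
      then show ?thesis using pCons by (intro exI[of _ "pCons a p"]) auto
    qed
  qed simp
  then obtain q :: "'a poly" where q: "poly q 0 \<noteq> 0" "poly (map_poly to_ac q) x = 0" by blast
  have "(0, poly (map_poly to_ac q) 0) \<in> G"
    using poly_base[OF assms, of q] q(2) by simp
  then have "poly (map_poly to_ac q) 0 = 0" by (rule kernel)
  then show False
    using q(1) by (simp add: poly_0_coeff_0 coeff_map_poly)
qed

text \<open>Represents polynomials over the domain of \<open>G\<close> together with their images,
  without forming that domain as a ring.\<close>

definition graph_polys :: "('a alg_closure poly \<times> 'a alg_closure poly) set" where
  "graph_polys = {(p, q). \<forall>i. (Polynomial.coeff p i, Polynomial.coeff q i) \<in> G}"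

lemma graph_polys_add: "(p, q) \<in> graph_polys \<Longrightarrow> (p', q') \<in> graph_polys \<Longrightarrow> (p + p', q + q') \<in> graph_polys"
  by (auto simp: graph_polys_def add)

lemma graph_polys_diff: "(p, q) \<in> graph_polys \<Longrightarrow> (p', q') \<in> graph_polys \<Longrightarrow> (p - p', q - q') \<in> graph_polys"
  by (auto simp: graph_polys_def diff)

lemma graph_polys_mult: "(p, q) \<in> graph_polys \<Longrightarrow> (p', q') \<in> graph_polys \<Longrightarrow> (p * p', q * q') \<in> graph_polys"
  by (auto simp: graph_polys_def coeff_mult intro!: sum mult)

lemma graph_polys_monom: "(a, b) \<in> G \<Longrightarrow> (Polynomial.monom a n, Polynomial.monom b n) \<in> graph_polys"
  by (auto simp: graph_polys_def zero)

text \<open>Zero coefficients must correspond to zero coefficients: one direction is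
  \<open>kernel\<close>, the other is \<open>injective\<close> and thus algebraicity.\<close>

lemma graph_polys_degree:
  assumes "(p, q) \<in> graph_polys"
  shows "Polynomial.degree q = Polynomial.degree p"
proof (rule antisym)
  show "Polynomial.degree q \<le> Polynomial.degree p"
  proof (rule degree_le, intro allI impI)
    fix i assume "Polynomial.degree p < i"
    then show "Polynomial.coeff q i = 0"
      using assms kernel[of "Polynomial.coeff q i"] by (auto simp: graph_polys_def coeff_eq_0 dest!: spec[of _ i])
  qed
  show "Polynomial.degree p \<le> Polynomial.degree q"
  proof (rule degree_le, intro allI impI)
    fix i assume "Polynomial.degree q < i"
    then show "Polynomial.coeff p i = 0"
      using assms injective[of "Polynomial.coeff p i"] by (auto simp: graph_polys_def coeff_eq_0 dest!: spec[of _ i])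
  qed
qed

text \<open>
  Sends \<open>x\<close> to a root \<open>y\<close> of the image of its minimal polynomial \<open>m\<close>; pseudo-division by \<open>m\<close>
  shows that this is well defined.
\<close>

lemma extend_to:
  "\<exists>G'. hom_graph G' \<and> G \<subseteq> G' \<and> (\<exists>y. (x, y) \<in> G')"
proof -
  \<comment> \<open>Polynomials over the domain of \<open>G\<close> with root \<open>x\<close>. That
    domain is only known to be a ring, so a member of least degree cannot be made monic.\<close>
  define Z where "Z = {p. \<exists>q. (p, q) \<in> graph_polys \<and> p \<noteq> 0 \<and> poly p x = 0}"
  obtain p :: "'a poly" where p: "p \<noteq> 0" "poly (map_poly to_ac p) x = 0"
    by (rule alg_closure_algebraic)
  have "(map_poly to_ac p, map_poly to_ac p) \<in> graph_polys"
    by (auto simp: graph_polys_def coeff_map_poly base)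
  moreover have "map_poly to_ac p \<noteq> 0" using p(1) by (simp add: map_poly_eq_0_iff)
  ultimately have "map_poly to_ac p \<in> Z" using p unfolding Z_def by blast
  then obtain m where "m \<in> Z" and min: "\<And>p. p \<in> Z \<Longrightarrow> Polynomial.degree m \<le> Polynomial.degree p"
    using ex_has_least_nat[of "\<lambda>p. p \<in> Z" _ Polynomial.degree] by blast
  then obtain m' where m: "(m, m') \<in> graph_polys" "m \<noteq> 0" "poly m x = 0"
    by (auto simp: Z_def)
  have deg_m: "Polynomial.degree m' = Polynomial.degree m" by (rule graph_polys_degree[OF m(1)])
  have lead_m: "(Polynomial.lead_coeff m, Polynomial.lead_coeff m') \<in> G"
    using m(1) unfolding deg_m by (auto simp: graph_polys_def)
  have "m' \<noteq> 0"
    using m injective[of "Polynomial.lead_coeff m"] lead_m by auto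
  have "Polynomial.degree m > 0"
  proof (rule ccontr)
    assume "\<not> Polynomial.degree m > 0"
    then obtain c where "m = [:c:]" using degree_eq_zeroE by blast
    then show False using m by simp
  qed
  then obtain y where y: "poly m' y = 0"
    using alg_closed_imp_poly_has_root[of m'] deg_m by auto
  have vanish: "poly q y = 0" if "(p, q) \<in> graph_polys" "poly p x = 0" for p q
    using that
  proof (induction "Polynomial.degree p" arbitrary: p q rule: less_induct)
    case less
    have deg: "Polynomial.degree q = Polynomial.degree p" by (rule graph_polys_degree[OF less.prems(1)])
    show ?case
    proof (cases "p = 0")
      case True
      then have "Polynomial.coeff q i = 0" for i
        using less.prems(1) kernel[of "Polynomial.coeff q i"] by (auto simp: graph_polys_def)
      then show ?thesis by (simp add: poly_eqI[of q 0])
    next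
      case False
      then have le: "Polynomial.degree m \<le> Polynomial.degree p"
        using less.prems by (intro min) (auto simp: Z_def)
      define d where "d = Polynomial.degree p - Polynomial.degree m"
      have lead_p: "(Polynomial.lead_coeff p, Polynomial.lead_coeff q) \<in> G"
        using less.prems(1) unfolding deg by (auto simp: graph_polys_def)
      \<comment> \<open>Cross multiplication by the leading coefficients cancels the leading terms.
        At \<open>y\<close> the second summand of \<open>r'\<close> vanishes and
        \<open>Polynomial.lead_coeff m'\<close> is nonzero, so the claim for \<open>r'\<close> gives
        the claim for \<open>q\<close>.\<close>
      define r where "r = Polynomial.monom (Polynomial.lead_coeff m) 0 * p -
        Polynomial.monom (Polynomial.lead_coeff p) d * m"
      define r' where "r' = Polynomial.monom (Polynomial.lead_coeff m') 0 * q -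
        Polynomial.monom (Polynomial.lead_coeff q) d * m'"
      have rr: "(r, r') \<in> graph_polys"
        unfolding r_def r'_def
        by (intro graph_polys_diff graph_polys_mult graph_polys_monom lead_m lead_p less.prems m)
      have r0: "poly r x = 0" using less.prems m by (simp add: r_def)
      have "poly r' y = 0"
      proof (cases "Polynomial.degree p = 0")
        case True
        then obtain c where "p = [:c:]" using degree_eq_zeroE by blast
        then show ?thesis using less.prems False by simp
      next
        case pos: False
        have "Polynomial.degree r < Polynomial.degree p"
        proof (rule degree_lessI)
          show "r \<noteq> 0 \<or> Polynomial.degree p > 0" using pos by simp
          show "\<forall>k\<ge>Polynomial.degree p. Polynomial.coeff r k = 0"
          proof (intro allI impI)
            fix k assume k: "k \<ge> Polynomial.degree p"
            show "Polynomial.coeff r k = 0"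
            proof (cases "k = Polynomial.degree p")
              case True
              then show ?thesis using le
                by (simp add: r_def d_def coeff_monom_mult
                    mult.commute[of "Polynomial.lead_coeff m" "Polynomial.lead_coeff p"])
            next
              case False
              then show ?thesis using k le
                by (simp add: r_def d_def coeff_monom_mult coeff_eq_0)
            qed
          qed
        qed
        then show ?thesis using less.hyps rr r0 by blast
      qed
      then show ?thesis using y \<open>m' \<noteq> 0\<close> by (simp add: r'_def poly_monom)
    qed
  qed
  \<comment> \<open>Evaluation at \<open>x\<close> and \<open>y\<close>; the fact
    \<open>vanish\<close> is the kernel condition for this relation.\<close>
  define G' where "G' = {(poly p x, poly q y) | p q. (p, q) \<in> graph_polys}"
  have sub: "G \<subseteq> G'"
  proof
    fix z assume "z \<in> G"
    then obtain a b where z: "z = (a, b)" "(a, b) \<in> G" by (cases z) auto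
    have "z = (poly (Polynomial.monom a 0) x, poly (Polynomial.monom b 0) y)"
      by (simp add: z poly_monom)
    then show "z \<in> G'"
      unfolding G'_def using graph_polys_monom[OF z(2), of 0] by blast
  qed
  moreover have "hom_graph G'"
  proof
    show "(to_ac a, to_ac a) \<in> G'" for a using base sub by blast
    show "(u + u', v + v') \<in> G'" if "(u, v) \<in> G'" "(u', v') \<in> G'" for u v u' v'
      using that unfolding G'_def by clarsimp (metis graph_polys_add poly_add)
    show "(u * u', v * v') \<in> G'" if "(u, v) \<in> G'" "(u', v') \<in> G'" for u v u' v'
      using that unfolding G'_def by clarsimp (metis graph_polys_mult poly_mult)
    show "v = 0" if "(0, v) \<in> G'" for v
      using that vanish unfolding G'_def by auto
  qed
  moreover have "(x, y) \<in> G'"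
  proof -
    have "(x, y) = (poly (Polynomial.monom 1 1) x, poly (Polynomial.monom 1 1) y)"
      by (simp add: poly_monom)
    then show ?thesis
      unfolding G'_def using graph_polys_monom[OF one, of 1] by blast
  qed
  ultimately show ?thesis by blast
qed

text \<open>A graph that is maximal above \<open>G\<close> is total, since otherwise
  \<open>extend_to\<close> would enlarge it.\<close>

theorem extend_to_UNIV:
  "\<exists>\<sigma>. base_hom UNIV \<sigma> \<and> (\<forall>(x, y)\<in>G. \<sigma> x = y)"
proof -
  define \<H> where "\<H> = {H. hom_graph H \<and> G \<subseteq> H}"
  have "G \<in> \<H>" using hom_graph_axioms by (auto simp: \<H>_def)
  have "\<exists>M\<in>\<H>. (\<forall>Y\<in>\<H>. M \<subseteq> Y \<longrightarrow> Y = M)"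
  proof (rule subset_Zorn)
    fix C assume C: "subset.chain \<H> C"
    show "\<exists>U\<in>\<H>. \<forall>Y\<in>C. Y \<subseteq> U"
    proof (cases "C = {}")
      case True
      then show ?thesis using \<open>G \<in> \<H>\<close> by blast
    next
      case False
      have common: "\<exists>Y\<in>C. u \<in> Y \<and> v \<in> Y" if "u \<in> \<Union>C" "v \<in> \<Union>C" for u v
        using that C unfolding subset_chain_def by blast
      have hg: "hom_graph Y" if "Y \<in> C" for Y using C that by (auto simp: subset_chain_def \<H>_def)
      have "hom_graph (\<Union>C)"
      proof
        show "(to_ac a, to_ac a) \<in> \<Union>C" for a using False hg hom_graph.base by fastforce
        show "(x + x', y + y') \<in> \<Union>C" if "(x, y) \<in> \<Union>C" "(x', y') \<in> \<Union>C" for x y x' y'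
          using common[OF that] hg hom_graph.add by blast
        show "(x * x', y * y') \<in> \<Union>C" if "(x, y) \<in> \<Union>C" "(x', y') \<in> \<Union>C" for x y x' y'
          using common[OF that] hg hom_graph.mult by blast
        show "y = 0" if "(0, y) \<in> \<Union>C" for y
          using that hg hom_graph.kernel by blast
      qed
      moreover have "G \<subseteq> \<Union>C"
      proof -
        obtain Y where "Y \<in> C" using False by blast
        moreover have "G \<subseteq> Y" using C \<open>Y \<in> C\<close> by (auto simp: subset_chain_def \<H>_def)
        ultimately show ?thesis by blast
      qed
      ultimately show ?thesis by (auto simp: \<H>_def)
    qed
  qed
  then obtain M where "M \<in> \<H>" and M_max: "\<forall>Y\<in>\<H>. M \<subseteq> Y \<longrightarrow> Y = M" ..
  then have M: "hom_graph M" "G \<subseteq> M" by (simp_all add: \<H>_def)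
  then have max: "Y = M" if "hom_graph Y" "M \<subseteq> Y" for Y
    using M_max that by (auto simp: \<H>_def)
  interpret M: hom_graph M by (rule M)
  have "\<exists>y. (x, y) \<in> M" for x using M.extend_to[of x] max by blast
  then obtain \<sigma> where \<sigma>: "\<And>x. (x, \<sigma> x) \<in> M" by metis
  have eq: "\<sigma> x = y" if "(x, y) \<in> M" for x y using M.functional \<sigma> that by blast
  have "base_hom UNIV \<sigma>"
    by standard (auto intro!: eq M.base M.add M.mult \<sigma>)
  then show ?thesis using eq M(2) by blast
qed

end

text \<open>The graph of \<open>a + b s -> a - b s\<close> is closed under products because
  \<open>s\<^sup>2\<close> lies in \<open>K\<close>. Its kernel is trivial because
  \<open>a + b s = 0\<close> with nonzero \<open>b\<close> would put \<open>s\<close> into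
  \<open>K\<close>.\<close>

lemma exists_conjugation:
  fixes s :: "'a::field alg_closure"
  assumes "s\<^sup>2 = to_ac d" "s \<notin> range to_ac"
  shows "\<exists>\<sigma>. base_hom UNIV \<sigma> \<and> \<sigma> s = - s"
proof -
  define G where "G = {(to_ac a + to_ac b * s, to_ac a - to_ac b * s) | a b. True}"
  have G: "(to_ac a + to_ac b * s, to_ac a - to_ac b * s) \<in> G" for a b
    by (auto simp: G_def)
  have "hom_graph G"
  proof
    show "(to_ac a, to_ac a) \<in> G" for a using G[of a 0] by simp
    show "(x + x', y + y') \<in> G" if "(x, y) \<in> G" "(x', y') \<in> G" for x y x' y'
    proof -
      obtain a b a' b' where eq: "x = to_ac a + to_ac b * s" "y = to_ac a - to_ac b * s"
        "x' = to_ac a' + to_ac b' * s" "y' = to_ac a' - to_ac b' * s"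
        using \<open>(x, y) \<in> G\<close> \<open>(x', y') \<in> G\<close> unfolding G_def by blast
      show ?thesis unfolding eq using G[of "a + a'" "b + b'"] by (simp add: algebra_simps)
    qed
    show "(x * x', y * y') \<in> G" if "(x, y) \<in> G" "(x', y') \<in> G" for x y x' y'
    proof -
      obtain a b a' b' where eq: "x = to_ac a + to_ac b * s" "y = to_ac a - to_ac b * s"
        "x' = to_ac a' + to_ac b' * s" "y' = to_ac a' - to_ac b' * s"
        using \<open>(x, y) \<in> G\<close> \<open>(x', y') \<in> G\<close> unfolding G_def by blast
      have d: "to_ac d = s * s" using assms(1) by (simp add: power2_eq_square)
      show ?thesis
        unfolding eq using G[of "a * a' + b * b' * d" "a * b' + a' * b"]
        by (simp add: algebra_simps d)
    qed
    show "y = 0" if "(0, y) \<in> G" for y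
    proof -
      obtain a b where eq: "0 = to_ac a + to_ac b * s" "y = to_ac a - to_ac b * s"
        using \<open>(0, y) \<in> G\<close> by (auto simp: G_def)
      have "b = 0"
      proof (rule ccontr)
        assume "b \<noteq> 0"
        then have "s = to_ac (- a / b)"
          using eq(1) by (simp add: field_simps eq_neg_iff_add_eq_0)
        with assms(2) show False by blast
      qed
      then show ?thesis using eq by simp
    qed
  qed
  then obtain \<sigma> where "base_hom UNIV \<sigma>" "\<forall>(x, y)\<in>G. \<sigma> x = y"
    using hom_graph.extend_to_UNIV by blast
  then show ?thesis using G[of 0 1] by (intro exI[of _ \<sigma>]) auto
qed

section \<open>The arboreal Galois group\<close>

lemma ring_of_type_algebra_simps [simp]:
  "carrier (ring_of_type_algebra :: 'b::field ring) = UNIV"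
  "x \<otimes>\<^bsub>(ring_of_type_algebra :: 'b ring)\<^esub> y = x * y"
  "x \<oplus>\<^bsub>(ring_of_type_algebra :: 'b ring)\<^esub> y = x + y"
  "\<one>\<^bsub>(ring_of_type_algebra :: 'b ring)\<^esub> = 1"
  "\<zero>\<^bsub>(ring_of_type_algebra :: 'b ring)\<^esub> = 0"
  by (simp_all add: ring_of_type_algebra_def)

lemma ring_of_type_algebra_inverses:
  fixes x :: "'b::field"
  shows "\<ominus>\<^bsub>(ring_of_type_algebra :: 'b ring)\<^esub> x = - x"
    and "x \<noteq> 0 \<Longrightarrow> inv\<^bsub>(ring_of_type_algebra :: 'b ring)\<^esub> x = inverse x"
proof -
  interpret R: field "ring_of_type_algebra :: 'b ring" by (rule field_from_type_algebra)
  show "\<ominus>\<^bsub>(ring_of_type_algebra :: 'b ring)\<^esub> x = - x"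
    by (rule R.minus_equality) simp_all
  show "inv\<^bsub>(ring_of_type_algebra :: 'b ring)\<^esub> x = inverse x" if "x \<noteq> 0"
    by (rule R.comm_inv_char) (use that in simp_all)
qed

lemma generate_field_one: "(1 :: 'b::field) \<in> generate_field ring_of_type_algebra H"
  using generate_field.one[of "ring_of_type_algebra :: 'b ring"] by simp

lemma generate_field_uminus:
  fixes h :: "'b::field"
  shows "h \<in> generate_field ring_of_type_algebra H \<Longrightarrow> - h \<in> generate_field ring_of_type_algebra H"
  using generate_field.a_inv[of h ring_of_type_algebra H] by (simp add: ring_of_type_algebra_inverses)

lemma generate_field_inverse:
  fixes h :: "'b::field"
  shows "h \<in> generate_field ring_of_type_algebra H \<Longrightarrow> inverse h \<in> generate_field ring_of_type_algebra H"
  using generate_field.m_inv[of h ring_of_type_algebra H]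
  by (cases "h = 0") (simp_all add: ring_of_type_algebra_inverses)

lemma generate_field_add:
  fixes u v :: "'b::field"
  shows "u \<in> generate_field ring_of_type_algebra H \<Longrightarrow> v \<in> generate_field ring_of_type_algebra H \<Longrightarrow>
    u + v \<in> generate_field ring_of_type_algebra H"
  using generate_field.eng_add[of u ring_of_type_algebra H v] by simp

lemma generate_field_mult:
  fixes u v :: "'b::field"
  shows "u \<in> generate_field ring_of_type_algebra H \<Longrightarrow> v \<in> generate_field ring_of_type_algebra H \<Longrightarrow>
    u * v \<in> generate_field ring_of_type_algebra H"
  using generate_field.eng_mult[of u ring_of_type_algebra H v] by simp

context
  fixes \<sigma> :: "'a::field alg_closure \<Rightarrow> 'a alg_closure"
  assumes \<sigma>: "base_hom UNIV \<sigma>"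
begin

interpretation base_hom UNIV \<sigma> by (rule \<sigma>)

lemma base_hom_UNIV_inj: "inj \<sigma>"
proof (rule injI)
  fix x y assume "\<sigma> x = \<sigma> y"
  then have "\<sigma> (x - y) = 0" by (simp add: hom_diff)
  then have "\<sigma> ((x - y) * inverse (x - y)) = 0" by (subst hom_mult) auto
  then show "x = y" using hom_one by (cases "x - y = 0") auto
qed

lemma base_hom_UNIV_minus: "\<sigma> (- x) = - \<sigma> x"
  using hom_diff[of 0 x] hom_base[of 0] by simp

lemma base_hom_UNIV_inverse: "\<sigma> (inverse x) = inverse (\<sigma> x)"
proof (cases "x = 0")
  case False
  then have "\<sigma> x * \<sigma> (inverse x) = 1" using hom_mult[of x "inverse x"] hom_one by simp
  then show ?thesis by (metis inverse_unique)
qed (use hom_base[of 0] in simp)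

lemma image_generate_field:
  assumes "\<sigma> ` S = S"
  shows "\<sigma> ` generate_field ring_of_type_algebra (range to_ac \<union> S) =
    generate_field ring_of_type_algebra (range to_ac \<union> S)" (is "\<sigma> ` ?G = ?G")
proof
  have "\<sigma> x \<in> ?G" if "x \<in> ?G" for x
    using that
  proof induction
    case (incl h)
    then have "\<sigma> h \<in> range to_ac \<union> S" using assms by (auto simp: hom_base)
    then show ?case by (rule generate_field.incl)
  next
    case (m_inv h)
    then show ?case
      by (simp add: ring_of_type_algebra_inverses base_hom_UNIV_inverse generate_field_inverse)
  next
    case one
    then show ?case by (simp add: hom_one generate_field_one)
  qed (simp_all add: hom_add hom_mult ring_of_type_algebra_inverses base_hom_UNIV_minus
      generate_field_uminus generate_field_add generate_field_mult)
  then show "\<sigma> ` ?G \<subseteq> ?G" by blast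
  have "x \<in> \<sigma> ` ?G" if "x \<in> ?G" for x
    using that
  proof induction
    case one
    then show ?case by (intro image_eqI[of _ _ 1]) (simp_all add: hom_one generate_field_one)
  next
    case (incl h)
    show ?case
    proof (cases "h \<in> S")
      case True
      then obtain k where "k \<in> S" "h = \<sigma> k" using assms by blast
      then show ?thesis by (auto intro: generate_field.incl)
    next
      case False
      then have "h = \<sigma> h" using incl by (auto simp: hom_base)
      then show ?thesis using incl by (metis generate_field.incl imageI)
    qed
  next
    case (a_inv h)
    then obtain k where "k \<in> ?G" "h = \<sigma> k" by blast
    then show ?case
      by (intro image_eqI[of _ _ "- k"])
        (simp_all add: ring_of_type_algebra_inverses base_hom_UNIV_minus generate_field_uminus)
  next
    case (m_inv h)
    then obtain k where k: "k \<in> ?G" "h = \<sigma> k" by blast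
    then show ?case using m_inv
      by (intro image_eqI[of _ _ "inverse k"])
        (simp_all add: ring_of_type_algebra_inverses base_hom_UNIV_inverse generate_field_inverse)
  next
    case (eng_add h1 h2)
    then obtain k1 k2 where "k1 \<in> ?G" "h1 = \<sigma> k1" "k2 \<in> ?G" "h2 = \<sigma> k2" by blast
    then show ?case
      by (intro image_eqI[of _ _ "k1 + k2"]) (simp_all add: hom_add generate_field_add)
  next
    case (eng_mult h1 h2)
    then obtain k1 k2 where "k1 \<in> ?G" "h1 = \<sigma> k1" "k2 \<in> ?G" "h2 = \<sigma> k2" by blast
    then show ?case
      by (intro image_eqI[of _ _ "k1 * k2"]) (simp_all add: hom_mult generate_field_mult)
  qed
  then show "?G \<subseteq> \<sigma> ` ?G" by blast
qed

end

section \<open>The fields \<open>K_n\<close>, their union, and homomorphisms on them\<close>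

lemma sub_preimage_field:
  "to_ac a \<in> preimage_field f x\<^sub>0 n" "y \<in> iter_preimage f x\<^sub>0 n \<Longrightarrow> y \<in> preimage_field f x\<^sub>0 n"
  by (auto simp: preimage_field_def intro: generate_field.incl)

lemma preimage_field_add:
  "u \<in> preimage_field f x\<^sub>0 n \<Longrightarrow> v \<in> preimage_field f x\<^sub>0 n \<Longrightarrow> u + v \<in> preimage_field f x\<^sub>0 n"
  and preimage_field_mult:
  "u \<in> preimage_field f x\<^sub>0 n \<Longrightarrow> v \<in> preimage_field f x\<^sub>0 n \<Longrightarrow> u * v \<in> preimage_field f x\<^sub>0 n"
  by (simp_all add: preimage_field_def generate_field_add generate_field_mult)

text \<open>With the identity as homomorphism, the locale shows that polynomials over
  \<open>K\<close> take values in the field at its elements.\<close>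

lemma base_hom_preimage_field: "base_hom (preimage_field f x\<^sub>0 n) id"
  by standard (auto intro: sub_preimage_field preimage_field_add preimage_field_mult)

locale cubic_arboreal =
  fixes f :: "'a::field poly" and x\<^sub>0 :: 'a
  assumes deg_f: "Polynomial.degree f = 3"
    and noncritical: "\<And>n. critical_points f \<inter> iter_preimage f x\<^sub>0 n = {}"
begin

abbreviation F where "F \<equiv> map_poly to_ac f"
abbreviation L where "L \<equiv> preimage_field_inf f x\<^sub>0"
abbreviation T where "T \<equiv> backward_orbit_tree f x\<^sub>0"

lemma deg_F: "Polynomial.degree F = 3"
  using deg_f by (simp add: degree_map_poly)

lemma poly_F: "poly F = ac_map f"
  by (simp add: ac_map_def)

lemma iter_preimage_fiber: "iter_preimage f x\<^sub>0 n = fiber (ac_map f) n (to_ac x\<^sub>0)"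
  by (simp add: iter_preimage_def fiber_def)

lemma uncritical_x0: "uncritical F (to_ac x\<^sub>0)"
  using noncritical by (auto simp: uncritical_def critical_points_def iter_preimage_fiber poly_F)

lemma uncritical_preimage: "y \<in> iter_preimage f x\<^sub>0 n \<Longrightarrow> uncritical F y"
  using uncritical_fiber[OF uncritical_x0] by (simp add: poly_F iter_preimage_fiber)

lemma iter_preimage_Suc: "y \<in> iter_preimage f x\<^sub>0 (Suc n) \<longleftrightarrow> ac_map f y \<in> iter_preimage f x\<^sub>0 n"
  by (simp add: iter_preimage_def funpow_swap1)

text \<open>Every \<open>y\<close> at level \<open>n\<close> is \<open>f(z)\<close> for some
  \<open>z\<close> one level farther from the root, and \<open>f\<close> has coefficients in
  \<open>K\<close>.\<close>

lemma preimage_field_mono: "preimage_field f x\<^sub>0 n \<subseteq> preimage_field f x\<^sub>0 (Suc n)"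
proof -
  interpret R: field "ring_of_type_algebra :: 'a alg_closure ring" by (rule field_from_type_algebra)
  interpret base_hom "preimage_field f x\<^sub>0 (Suc n)" id by (rule base_hom_preimage_field)
  have "y \<in> preimage_field f x\<^sub>0 (Suc n)" if y: "y \<in> iter_preimage f x\<^sub>0 n" for y
  proof -
    have "Polynomial.degree (iter_poly F 1 - [:y:]) > 0"
      using degree_fiber_poly[OF deg_F, of 1 y] by simp
    then obtain z where "poly (iter_poly F 1 - [:y:]) z = 0"
      using alg_closed_imp_poly_has_root by blast
    then have z: "ac_map f z = y"
      by (simp add: poly_pcompose poly_F)
    then have "z \<in> preimage_field f x\<^sub>0 (Suc n)"
      using y by (intro sub_preimage_field) (simp add: iter_preimage_Suc)
    then show ?thesis using poly_mem[of z f] z by (simp add: poly_F)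
  qed
  then show ?thesis
    unfolding preimage_field_def[of f x\<^sub>0 n]
    using sub_preimage_field(1)[of _ f x\<^sub>0 "Suc n"]
    by (intro R.generate_field_min_subfield1)
       (auto simp: preimage_field_def intro!: R.generate_field_is_subfield)
qed

lemma preimage_field_le: "m \<le> n \<Longrightarrow> preimage_field f x\<^sub>0 m \<subseteq> preimage_field f x\<^sub>0 n"
  by (rule lift_Suc_mono_le[of "preimage_field f x\<^sub>0"]) (use preimage_field_mono in auto)

lemma base_mem_L: "to_ac a \<in> L"
  by (auto simp: preimage_field_inf_def intro: sub_preimage_field)

lemma preimage_mem_L: "y \<in> iter_preimage f x\<^sub>0 n \<Longrightarrow> y \<in> L"
  by (auto simp: preimage_field_inf_def intro: sub_preimage_field)

lemma common_preimage_field: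
  assumes "u \<in> L" "v \<in> L"
  obtains n where "u \<in> preimage_field f x\<^sub>0 n" "v \<in> preimage_field f x\<^sub>0 n"
proof -
  obtain i j where "u \<in> preimage_field f x\<^sub>0 i" "v \<in> preimage_field f x\<^sub>0 j"
    using assms by (auto simp: preimage_field_inf_def)
  then show ?thesis
    using that[of "max i j"] preimage_field_le[of i "max i j"] preimage_field_le[of j "max i j"] by auto
qed

lemma add_mem_L: "u \<in> L \<Longrightarrow> v \<in> L \<Longrightarrow> u + v \<in> L"
  by (erule (1) common_preimage_field) (auto simp: preimage_field_inf_def intro: preimage_field_add)

lemma mult_mem_L: "u \<in> L \<Longrightarrow> v \<in> L \<Longrightarrow> u * v \<in> L"
  by (erule (1) common_preimage_field) (auto simp: preimage_field_inf_def intro: preimage_field_mult)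

lemma arboreal_galois_group_iff:
  "\<sigma> \<in> arboreal_galois_group f x\<^sub>0 \<longleftrightarrow> \<sigma> \<in> Bij L \<and> base_hom L \<sigma>"
proof
  assume *: "\<sigma> \<in> arboreal_galois_group f x\<^sub>0"
  then have "\<sigma> \<in> ring_hom (ring_of_type_algebra\<lparr>carrier := L\<rparr>) (ring_of_type_algebra\<lparr>carrier := L\<rparr>)"
    "\<forall>x\<in>range to_ac. \<sigma> x = x"
    by (auto simp: arboreal_galois_group_def galois_group_def)
  then have "base_hom L \<sigma>"
    by unfold_locales (auto simp: ring_hom_def base_mem_L add_mem_L mult_mem_L)
  then show "\<sigma> \<in> Bij L \<and> base_hom L \<sigma>"
    using * by (auto simp: arboreal_galois_group_def galois_group_def)
next
  assume *: "\<sigma> \<in> Bij L \<and> base_hom L \<sigma>"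
  then interpret base_hom L \<sigma> by simp
  show "\<sigma> \<in> arboreal_galois_group f x\<^sub>0"
    using * Bij_imp_funcset[of \<sigma> L]
    by (auto simp: arboreal_galois_group_def galois_group_def ring_hom_def hom_one hom_add hom_mult hom_base)
qed

lemma finite_iter_preimage: "finite (iter_preimage f x\<^sub>0 n)"
  using finite_fiber[OF deg_F] by (simp add: iter_preimage_fiber poly_F)

lemma hom_preimage:
  assumes "base_hom M \<sigma>" "y \<in> iter_preimage f x\<^sub>0 n" "y \<in> M"
  shows "\<sigma> y \<in> iter_preimage f x\<^sub>0 n"
proof -
  interpret base_hom M \<sigma> by fact
  show ?thesis using assms hom_iter[of y n f] by (simp add: iter_preimage_def hom_base)
qed

text \<open>An injective self-map of a finite set is onto.\<close>

lemma hom_image_preimage: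
  assumes "base_hom M \<sigma>" "iter_preimage f x\<^sub>0 n \<subseteq> M" "inj_on \<sigma> M"
  shows "\<sigma> ` iter_preimage f x\<^sub>0 n = iter_preimage f x\<^sub>0 n"
  by (rule endo_inj_surj[OF finite_iter_preimage])
     (use assms hom_preimage inj_on_subset in blast)+

text \<open>Each \<open>K_n\<close> is generated over \<open>K\<close> by a set that
  \<open>\<sigma>\<close> permutes, so every \<open>K_n\<close>, and hence the union, is mapped onto
  itself.\<close>

lemma restrict_mem_galois_group:
  assumes "base_hom UNIV \<sigma>"
  shows "restrict \<sigma> L \<in> arboreal_galois_group f x\<^sub>0"
  unfolding arboreal_galois_group_iff
proof
  interpret base_hom UNIV \<sigma> by fact
  have "\<sigma> ` preimage_field f x\<^sub>0 n = preimage_field f x\<^sub>0 n" for n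
    unfolding preimage_field_def
    by (intro image_generate_field hom_image_preimage[OF assms] subset_UNIV base_hom_UNIV_inj assms)
  then have "\<sigma> ` L = L" unfolding preimage_field_inf_def by (simp add: image_UN)
  moreover have "inj_on \<sigma> L" using base_hom_UNIV_inj[OF assms] inj_on_subset by blast
  ultimately show "restrict \<sigma> L \<in> Bij L" by (auto simp: Bij_def bij_betw_def)
  show "base_hom L (restrict \<sigma> L)"
    by unfold_locales (auto simp: base_mem_L add_mem_L mult_mem_L hom_base hom_add hom_mult)
qed

section \<open>The action of the Galois group on the tree\<close>

lemma node_iff [simp]: "(n, y) \<in> tree_nodes T \<longleftrightarrow> y \<in> iter_preimage f x\<^sub>0 n"
  by (simp add: backward_orbit_tree_def)

lemma tree_simps [simp]:
  "tree_root T = (0, to_ac x\<^sub>0)" "tree_level T = fst" "tree_parent T (n, y) = (n - 1, ac_map f y)"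
  by (simp_all add: backward_orbit_tree_def)

lemma iter_preimage_0 [simp]: "iter_preimage f x\<^sub>0 0 = {to_ac x\<^sub>0}"
  by (auto simp: iter_preimage_def)

lemma arboreal_action_apply:
  "y \<in> iter_preimage f x\<^sub>0 n \<Longrightarrow> arboreal_action f x\<^sub>0 \<sigma> (n, y) = (n, \<sigma> y)"
  by (simp add: arboreal_action_def)

text \<open>Commuting with \<open>f\<close> and fixing \<open>x\<^sub>0\<close> preserves edges;
  injectivity on \<open>L\<close> makes the action reflect them as well.\<close>

lemma arboreal_action_automorphism:
  assumes "\<sigma> \<in> arboreal_galois_group f x\<^sub>0"
  shows "arboreal_action f x\<^sub>0 \<sigma> \<in> tree_automorphisms T"
proof -
  have hom: "base_hom L \<sigma>" and inj: "inj_on \<sigma> L"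
    using assms by (auto simp: arboreal_galois_group_iff Bij_def bij_betw_def)
  interpret base_hom L \<sigma> by fact
  let ?A = "arboreal_action f x\<^sub>0 \<sigma>"
  have "inj_on ?A (tree_nodes T)"
  proof (rule inj_onI)
    fix u v assume "u \<in> tree_nodes T" "v \<in> tree_nodes T" "?A u = ?A v"
    then show "u = v"
      using inj by (cases u; cases v) (auto simp: arboreal_action_apply inj_on_def dest: preimage_mem_L)
  qed
  moreover have "?A ` tree_nodes T = tree_nodes T"
  proof
    show "?A ` tree_nodes T \<subseteq> tree_nodes T"
      using hom_preimage[OF hom] preimage_mem_L by (auto simp: arboreal_action_apply)
    show "tree_nodes T \<subseteq> ?A ` tree_nodes T"
    proof
      fix v assume v: "v \<in> tree_nodes T"
      obtain n y where v_eq: "v = (n, y)" by (cases v)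
      have "\<sigma> ` iter_preimage f x\<^sub>0 n = iter_preimage f x\<^sub>0 n"
        using preimage_mem_L by (intro hom_image_preimage[OF hom _ inj]) blast
      then obtain z where z: "z \<in> iter_preimage f x\<^sub>0 n" "y = \<sigma> z"
        using v unfolding v_eq node_iff by blast
      then show "v \<in> ?A ` tree_nodes T"
        by (intro image_eqI[of _ _ "(n, z)"]) (simp_all add: v_eq arboreal_action_apply)
    qed
  qed
  ultimately have "?A \<in> Bij (tree_nodes T)"
    by (auto simp: Bij_def bij_betw_def arboreal_action_def)
  moreover have "?A (tree_root T) = tree_root T"
    by (simp add: arboreal_action_apply hom_base)
  moreover have "tree_adjacent T (?A u) (?A v) \<longleftrightarrow> tree_adjacent T u v"
    if "u \<in> tree_nodes T" "v \<in> tree_nodes T" for u v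
  proof -
    obtain m y n z where eq: "u = (m, y)" "v = (n, z)" by (cases u; cases v)
    have yz: "y \<in> iter_preimage f x\<^sub>0 m" "z \<in> iter_preimage f x\<^sub>0 n" using that eq by auto
    have "y \<in> L" "z \<in> L" using yz preimage_mem_L by auto
    have parent: "z' = ac_map f y' \<longleftrightarrow> \<sigma> z' = ac_map f (\<sigma> y')" if "y' \<in> L" "z' \<in> L" for y' z'
    proof -
      have "ac_map f y' \<in> L" "\<sigma> (ac_map f y') = ac_map f (\<sigma> y')"
        using hom_iter[of y' 1 f] iter_mem[of y' 1 f] that by simp_all
      then show ?thesis using inj_onD[OF inj, of z' "ac_map f y'"] that by metis
    qed
    have root: "y' = to_ac x\<^sub>0 \<longleftrightarrow> \<sigma> y' = to_ac x\<^sub>0" if "y' \<in> L" for y'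
      using inj that base_mem_L[of x\<^sub>0] hom_base[of x\<^sub>0] unfolding inj_on_def by metis
    show ?thesis
      unfolding eq tree_adjacent_def
      using yz hom_preimage[OF hom] \<open>y \<in> L\<close> \<open>z \<in> L\<close> parent[of y z] parent[of z y] root[of y] root[of z]
      by (simp add: arboreal_action_apply)
  qed
  ultimately show ?thesis by (simp add: tree_automorphisms_def)
qed

end

section \<open>Labelings and signs\<close>

lemma ternary_words_append: "p \<in> ternary_words n \<Longrightarrow> s \<in> ternary_words m \<Longrightarrow> p @ s \<in> ternary_words (n + m)"
  by (auto simp: ternary_words_def)

lemma ternary_words_take: "q \<in> ternary_words (n + m) \<Longrightarrow> take n q \<in> ternary_words n"
  by (auto simp: ternary_words_def dest: in_set_takeD)

lemma ternary_words_drop: "q \<in> ternary_words (n + m) \<Longrightarrow> drop n q \<in> ternary_words m"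
  by (auto simp: ternary_words_def dest: in_set_dropD)

lemma ternary_words_butlast: "q \<in> ternary_words (Suc n) \<Longrightarrow> butlast q \<in> ternary_words n"
  by (auto simp: ternary_words_def dest: in_set_butlastD)

lemma ternary_words_snoc: "q @ [i] \<in> ternary_words (Suc n) \<longleftrightarrow> q \<in> ternary_words n \<and> i < 3"
  by (auto simp: ternary_words_def)

lemma ternary_words_0 [simp]: "ternary_words 0 = {[]}"
  by (auto simp: ternary_words_def)

context cubic_arboreal
begin

text \<open>
  A labeling is handled through its inverse \<open>\<nu>\<close>, which sends a word of length \<open>n\<close> to the
  corresponding point of \<open>f\<^sup>-\<^sup>n(x\<^sub>0)\<close>.
\<close>

definition word_points :: "(nat list \<Rightarrow> 'a alg_closure) \<Rightarrow> bool" where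
  "word_points \<nu> \<longleftrightarrow> (\<forall>n. bij_betw \<nu> (ternary_words n) (iter_preimage f x\<^sub>0 n)) \<and>
     (\<forall>n. \<forall>q\<in>ternary_words (Suc n). ac_map f (\<nu> q) = \<nu> (butlast q))"

text \<open>The product \<open>V_l(y) V_{l-1}(y)\<close> at the node \<open>y = \<nu> p\<close>.
  Words are compared lexicographically, which fixes the signs of both Vandermonde products.\<close>

definition two_levels :: "nat \<Rightarrow> (nat list \<Rightarrow> 'a alg_closure) \<Rightarrow> nat list \<Rightarrow> 'a alg_closure" where
  "two_levels l \<nu> p = vandermonde (\<lambda>s. \<nu> (p @ s)) (ternary_words l) *
     vandermonde (\<lambda>s. \<nu> (p @ s)) (ternary_words (l - 1))"

lemma word_points_iter:
  assumes "word_points \<nu>" "p \<in> ternary_words n" "s \<in> ternary_words m"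
  shows "(ac_map f ^^ m) (\<nu> (p @ s)) = \<nu> p"
  using assms(3)
proof (induction m arbitrary: s)
  case (Suc m)
  have "s \<noteq> []" using Suc.prems by (auto simp: ternary_words_def)
  have "(ac_map f ^^ Suc m) (\<nu> (p @ s)) = (ac_map f ^^ m) (ac_map f (\<nu> (p @ s)))"
    by (simp add: funpow_swap1)
  also have "ac_map f (\<nu> (p @ s)) = \<nu> (butlast (p @ s))"
    using assms(1) ternary_words_append[OF assms(2) Suc.prems] by (simp add: word_points_def)
  also have "butlast (p @ s) = p @ butlast s" using \<open>s \<noteq> []\<close> by (simp add: butlast_append)
  also have "(ac_map f ^^ m) (\<nu> (p @ butlast s)) = \<nu> p"
    by (rule Suc.IH[OF ternary_words_butlast[OF Suc.prems]])
  finally show ?case .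
qed simp

text \<open>For surjectivity, a point of the fiber has some label of length \<open>n + m\<close>;
  the initial segment of length \<open>n\<close> labels \<open>\<nu> p\<close> and hence is
  \<open>p\<close>.\<close>

lemma word_points_fiber:
  assumes "word_points \<nu>" "p \<in> ternary_words n"
  shows "bij_betw (\<lambda>s. \<nu> (p @ s)) (ternary_words m) (fiber (ac_map f) m (\<nu> p))"
proof -
  have bij: "bij_betw \<nu> (ternary_words k) (iter_preimage f x\<^sub>0 k)" for k
    using assms(1) by (simp add: word_points_def)
  have "inj_on (\<lambda>s. \<nu> (p @ s)) (ternary_words m)"
  proof (rule inj_onI)
    fix s t assume "s \<in> ternary_words m" "t \<in> ternary_words m" "\<nu> (p @ s) = \<nu> (p @ t)"
    then show "s = t"
      using bij[of "n + m"] ternary_words_append[OF assms(2)] by (auto simp: bij_betw_def dest: inj_onD)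
  qed
  moreover have "(\<lambda>s. \<nu> (p @ s)) ` ternary_words m = fiber (ac_map f) m (\<nu> p)"
  proof
    show "(\<lambda>s. \<nu> (p @ s)) ` ternary_words m \<subseteq> fiber (ac_map f) m (\<nu> p)"
      using word_points_iter[OF assms] by (auto simp: fiber_def)
    show "fiber (ac_map f) m (\<nu> p) \<subseteq> (\<lambda>s. \<nu> (p @ s)) ` ternary_words m"
    proof
      fix w assume w: "w \<in> fiber (ac_map f) m (\<nu> p)"
      have "\<nu> p \<in> iter_preimage f x\<^sub>0 n" using bij assms(2) by (auto simp: bij_betw_def)
      then have "w \<in> iter_preimage f x\<^sub>0 (n + m)"
        using w by (simp add: fiber_def iter_preimage_def funpow_add)
      then obtain q where q: "q \<in> ternary_words (n + m)" "w = \<nu> q"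
        using bij[of "n + m"] by (auto simp: bij_betw_def)
      have "\<nu> (take n q) = \<nu> p"
        using word_points_iter[OF assms(1) ternary_words_take[OF q(1)] ternary_words_drop[OF q(1)]] w q(2)
        by (simp add: fiber_def)
      then have "take n q = p"
        using inj_onD[of \<nu> "ternary_words n"] bij[of n] ternary_words_take[OF q(1)] assms(2)
        by (auto simp: bij_betw_def)
      then show "w \<in> (\<lambda>s. \<nu> (p @ s)) ` ternary_words m"
        using q ternary_words_drop[OF q(1)] by (intro image_eqI[of _ _ "drop n q"]) auto
    qed
  qed
  ultimately show ?thesis by (simp add: bij_betw_def)
qed

lemma tree_labeling_node:
  assumes "tree_labeling T lab" "v \<in> tree_nodes T"
  shows "node_of_label T lab (lab v) = v" and "lab v \<in> ternary_words (fst v)"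
proof -
  have bij: "bij_betw lab {v \<in> tree_nodes T. tree_level T v = m} (ternary_words m)" for m
    using assms(1) by (simp add: tree_labeling_def)
  have mem: "lab u \<in> ternary_words (fst u)" if "u \<in> tree_nodes T" for u
    using bij[of "fst u"] that by (auto simp: bij_betw_def)
  then show "lab v \<in> ternary_words (fst v)" using assms(2) by blast
  have "inj_on lab (tree_nodes T)"
  proof (rule inj_onI)
    fix u v assume uv: "u \<in> tree_nodes T" "v \<in> tree_nodes T" "lab u = lab v"
    then have "fst u = fst v" using mem[of u] mem[of v] by (auto simp: ternary_words_def)
    then show "u = v" using bij[of "fst v"] uv by (auto simp: bij_betw_def dest: inj_onD)
  qed
  then show "node_of_label T lab (lab v) = v"
    unfolding node_of_label_def using assms(2) by (rule inv_into_f_f)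
qed

lemma tree_labeling_word:
  assumes "tree_labeling T lab" "w \<in> ternary_words n"
  shows "lab (node_of_label T lab w) = w" "node_of_label T lab w \<in> tree_nodes T"
    "fst (node_of_label T lab w) = n"
proof -
  have "bij_betw lab {v \<in> tree_nodes T. tree_level T v = n} (ternary_words n)"
    using assms(1) by (simp add: tree_labeling_def)
  then have "w \<in> lab ` {v \<in> tree_nodes T. tree_level T v = n}"
    using assms(2) by (simp add: bij_betw_def)
  then obtain v where v: "v \<in> tree_nodes T" "fst v = n" "lab v = w"
    unfolding tree_simps by blast
  then show "lab (node_of_label T lab w) = w" "node_of_label T lab w \<in> tree_nodes T"
    "fst (node_of_label T lab w) = n"
    using tree_labeling_node[OF assms(1) v(1)] by auto
qed

lemma word_points_of_labeling:
  assumes "tree_labeling T lab"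
  shows "word_points (\<lambda>w. snd (node_of_label T lab w))"
  unfolding word_points_def
proof (intro conjI allI ballI)
  let ?\<nu> = "\<lambda>w. snd (node_of_label T lab w)"
  note word = tree_labeling_word[OF assms] and node = tree_labeling_node[OF assms]
  have node_eq: "node_of_label T lab w = (n, ?\<nu> w)" if "w \<in> ternary_words n" for w n
    by (simp add: prod_eq_iff word(3)[OF that])
  show "bij_betw ?\<nu> (ternary_words n) (iter_preimage f x\<^sub>0 n)" for n
  proof (rule bij_betw_byWitness[of _ "\<lambda>y. lab (n, y)"])
    show "\<forall>w\<in>ternary_words n. lab (n, ?\<nu> w) = w"
      by (intro ballI, subst node_eq[symmetric]) (simp_all add: word(1))
    show "\<forall>y\<in>iter_preimage f x\<^sub>0 n. ?\<nu> (lab (n, y)) = y"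
      using node(1)[of "(n, _)"] by simp
    show "?\<nu> ` ternary_words n \<subseteq> iter_preimage f x\<^sub>0 n"
    proof (rule image_subsetI)
      fix w assume "w \<in> ternary_words n"
      then show "?\<nu> w \<in> iter_preimage f x\<^sub>0 n"
        using word(2)[of w n] node_eq[of w n] by (metis node_iff)
    qed
    show "(\<lambda>y. lab (n, y)) ` iter_preimage f x\<^sub>0 n \<subseteq> ternary_words n"
    proof (rule image_subsetI)
      fix y assume "y \<in> iter_preimage f x\<^sub>0 n"
      then show "lab (n, y) \<in> ternary_words n" using node(2)[of "(n, y)"] by simp
    qed
  qed
  fix n q assume q: "q \<in> ternary_words (Suc n)"
  define v where "v = node_of_label T lab q"
  have v: "v \<in> tree_nodes T" "fst v = Suc n" "lab v = q"
    using word[OF q] by (simp_all add: v_def)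
  have "v \<noteq> tree_root T" using v(2) by auto
  then have "lab (tree_parent T v) = butlast q"
    using assms v(1,3) by (simp add: tree_labeling_def)
  moreover have "tree_parent T v = (n, ac_map f (snd v))"
    using v(2) by (cases v) simp
  moreover have "ac_map f (snd v) \<in> iter_preimage f x\<^sub>0 n"
    using v by (cases v) (simp add: iter_preimage_Suc)
  ultimately show "ac_map f (?\<nu> q) = ?\<nu> (butlast q)"
    using node(1)[of "(n, ac_map f (snd v))"] by (simp add: v_def)
qed

text \<open>The equation \<open>\<nu> (p' @ \<pi> s) = \<sigma> (\<nu> (p @ s))\<close> says that
  \<open>\<sigma>\<close> acts on the roots through the label permutation \<open>\<pi>\<close>; then
  \<open>vandermonde_permute\<close> reads off its sign.\<close>

lemma hom_vandermonde_labeling: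
  fixes lab \<sigma>
  defines "\<nu> \<equiv> \<lambda>w. snd (node_of_label T lab w)"
  assumes lab: "tree_labeling T lab"
    and hom: "base_hom L \<sigma>" and inj: "inj_on \<sigma> L" and y: "y \<in> iter_preimage f x\<^sub>0 n"
  shows "\<sigma> (vandermonde (\<lambda>s. \<nu> (lab (n, y) @ s)) (ternary_words m)) =
    of_int (tree_sgn T lab m (arboreal_action f x\<^sub>0 \<sigma>) (n, y)) *
    vandermonde (\<lambda>s. \<nu> (lab (n, \<sigma> y) @ s)) (ternary_words m)"
proof -
  interpret base_hom L \<sigma> by fact
  note word = tree_labeling_word[OF lab] and node = tree_labeling_node[OF lab]
  have wp: "word_points \<nu>" unfolding \<nu>_def by (rule word_points_of_labeling[OF lab])
  have bij: "bij_betw \<nu> (ternary_words k) (iter_preimage f x\<^sub>0 k)" for k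
    using wp by (simp add: word_points_def)
  define p where "p = lab (n, y)"
  define p' where "p' = lab (n, \<sigma> y)"
  define \<pi> where "\<pi> = label_permutation T lab m (arboreal_action f x\<^sub>0 \<sigma>) (n, y)"
  have y': "\<sigma> y \<in> iter_preimage f x\<^sub>0 n" by (rule hom_preimage[OF hom y preimage_mem_L[OF y]])
  have p: "p \<in> ternary_words n" "p' \<in> ternary_words n"
    using node(2)[of "(n, y)"] node(2)[of "(n, \<sigma> y)"] y y' by (simp_all add: p_def p'_def)
  have \<nu>p: "\<nu> p = y" "\<nu> p' = \<sigma> y"
    using node(1)[of "(n, y)"] node(1)[of "(n, \<sigma> y)"] y y' by (simp_all add: p_def p'_def \<nu>_def)
  have pre: "\<nu> (p @ s) \<in> iter_preimage f x\<^sub>0 (n + m)" if "s \<in> ternary_words m" for s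
    using bij[of "n + m"] ternary_words_append[OF p(1) that] by (auto simp: bij_betw_def)
  have \<pi>: "\<pi> s \<in> ternary_words m \<and> \<nu> (p' @ \<pi> s) = \<sigma> (\<nu> (p @ s))" if s: "s \<in> ternary_words m" for s
  proof -
    have ps: "p @ s \<in> ternary_words (n + m)" by (rule ternary_words_append[OF p(1) s])
    have node_ps: "node_of_label T lab (p @ s) = (n + m, \<nu> (p @ s))"
      using word(3)[OF ps] by (metis \<nu>_def prod.collapse)
    have inL: "\<nu> (p @ s) \<in> L" using pre[OF s] preimage_mem_L by blast
    \<comment> \<open>The fiber over \<open>y\<close> is mapped into the fiber over
      \<open>\<sigma> y\<close>. This provides the word \<open>t\<close> picked by the definite
      description in \<open>label_permutation\<close>.\<close>
    have "\<sigma> (\<nu> (p @ s)) \<in> fiber (ac_map f) m (\<nu> p')"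
      using hom_iter[OF inL, of m f] word_points_iter[OF wp p(1) s] by (simp add: fiber_def \<nu>p)
    then obtain t where t: "t \<in> ternary_words m" "\<sigma> (\<nu> (p @ s)) = \<nu> (p' @ t)"
      using word_points_fiber[OF wp p(2), of m] by (auto simp: bij_betw_def)
    have pt: "p' @ t \<in> ternary_words (n + m)" by (rule ternary_words_append[OF p(2) t(1)])
    have "lab (n + m, \<nu> (p' @ t)) = p' @ t"
      using word[OF pt] by (metis \<nu>_def prod.collapse)
    then have "lab (arboreal_action f x\<^sub>0 \<sigma> (node_of_label T lab (lab (n, y) @ s))) = p' @ t"
      using pre[OF s] t(2) node_ps by (simp add: arboreal_action_apply flip: p_def)
    then have "\<pi> s = t"
      using s y by (simp add: \<pi>_def label_permutation_def arboreal_action_apply p'_def)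
    then show ?thesis using t by simp
  qed
  have "\<pi> permutes ternary_words m"
  proof (rule bij_imp_permutes)
    have "inj_on \<pi> (ternary_words m)"
    proof (rule inj_onI)
      fix s t assume st: "s \<in> ternary_words m" "t \<in> ternary_words m" "\<pi> s = \<pi> t"
      then have "\<sigma> (\<nu> (p @ s)) = \<sigma> (\<nu> (p @ t))" using \<pi> by metis
      then have "\<nu> (p @ s) = \<nu> (p @ t)"
        using inj pre st preimage_mem_L by (meson inj_onD)
      then show "s = t"
        using word_points_fiber[OF wp p(1), of m] st by (auto simp: bij_betw_def dest: inj_onD)
    qed
    moreover have "\<pi> ` ternary_words m \<subseteq> ternary_words m" using \<pi> by blast
    ultimately show "bij_betw \<pi> (ternary_words m) (ternary_words m)"
      by (simp add: bij_betw_def endo_inj_surj)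
  qed (simp add: \<pi>_def label_permutation_def)
  then have "vandermonde (\<lambda>s. \<nu> (p' @ \<pi> s)) (ternary_words m) =
      of_int (sign \<pi>) * vandermonde (\<lambda>s. \<nu> (p' @ s)) (ternary_words m)"
    using vandermonde_permute[OF finite_ternary_words, of \<pi> m "\<lambda>s. \<nu> (p' @ s)"] by simp
  moreover have "\<sigma> (vandermonde (\<lambda>s. \<nu> (p @ s)) (ternary_words m)) =
      vandermonde (\<lambda>s. \<sigma> (\<nu> (p @ s))) (ternary_words m)"
    using pre preimage_mem_L by (intro hom_vandermonde) blast
  moreover have "\<dots> = vandermonde (\<lambda>s. \<nu> (p' @ \<pi> s)) (ternary_words m)"
    by (rule vandermonde_cong) (simp add: \<pi>)
  ultimately show ?thesis by (simp add: p_def p'_def tree_sgn_def \<pi>_def)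
qed

corollary hom_two_levels:
  fixes lab \<sigma>
  defines "\<nu> \<equiv> \<lambda>w. snd (node_of_label T lab w)"
  assumes lab: "tree_labeling T lab"
    and hom: "base_hom L \<sigma>" and inj: "inj_on \<sigma> L" and y: "y \<in> iter_preimage f x\<^sub>0 n"
  shows "\<sigma> (two_levels l \<nu> (lab (n, y))) =
    of_int (tree_sgn T lab l (arboreal_action f x\<^sub>0 \<sigma>) (n, y) *
      tree_sgn T lab (l - 1) (arboreal_action f x\<^sub>0 \<sigma>) (n, y)) * two_levels l \<nu> (lab (n, \<sigma> y))"
    and "two_levels l \<nu> (lab (n, y)) \<in> L"
proof -
  interpret base_hom L \<sigma> by fact
  have wp: "word_points \<nu>" unfolding \<nu>_def by (rule word_points_of_labeling[OF lab])
  have "\<nu> (lab (n, y) @ s) \<in> L" if "s \<in> ternary_words m" for s m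
  proof -
    have "lab (n, y) @ s \<in> ternary_words (n + m)"
      using tree_labeling_node(2)[OF lab, of "(n, y)"] y that by (intro ternary_words_append) auto
    then show ?thesis
      using wp preimage_mem_L[of "\<nu> (lab (n, y) @ s)" "n + m"] by (auto simp: word_points_def bij_betw_def)
  qed
  then have mem: "vandermonde (\<lambda>s. \<nu> (lab (n, y) @ s)) (ternary_words m) \<in> L" for m
    by (intro vandermonde_mem)
  show "\<sigma> (two_levels l \<nu> (lab (n, y))) =
    of_int (tree_sgn T lab l (arboreal_action f x\<^sub>0 \<sigma>) (n, y) *
      tree_sgn T lab (l - 1) (arboreal_action f x\<^sub>0 \<sigma>) (n, y)) * two_levels l \<nu> (lab (n, \<sigma> y))"
    unfolding two_levels_def hom_mult[OF mem mem]
    using hom_vandermonde_labeling[OF lab hom inj y] by (simp add: \<nu>_def mult_ac)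
  show "two_levels l \<nu> (lab (n, y)) \<in> L"
    unfolding two_levels_def by (intro mult_mem mem)
qed

end

section \<open>The collision\<close>

lemma char_ne_imp_ne_zero:
  assumes "CHAR('b::field) \<noteq> p" "prime p"
  shows "(of_nat p :: 'b) \<noteq> 0"
  using assms by (auto simp: of_nat_eq_0_iff_char_dvd prime_nat_iff)

lemma degree_pderiv_le: "Polynomial.degree (pderiv p) \<le> Polynomial.degree p - 1"
  by (rule degree_le) (auto simp: coeff_pderiv coeff_eq_0)

lemma pderiv_map_to_ac: "pderiv (map_poly to_ac f) = map_poly to_ac (pderiv f)"
  by (rule poly_eqI) (simp add: coeff_pderiv coeff_map_poly)

text \<open>Characteristic other than 3 keeps the degree of \<open>f'\<close> at 2, so its two
  distinct roots are simple and account for all of it.\<close>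

lemma pderiv_eq_critical_points:
  fixes f :: "'a::field poly"
  assumes "CHAR('a) \<noteq> 3" "Polynomial.degree f = 3"
    and "critical_points f = {\<gamma>\<^sub>1, \<gamma>\<^sub>2}" "\<gamma>\<^sub>1 \<noteq> \<gamma>\<^sub>2"
  shows "pderiv (map_poly to_ac f) =
    Polynomial.smult (3 * Polynomial.lead_coeff (map_poly to_ac f)) ([:-\<gamma>\<^sub>1, 1:] * [:-\<gamma>\<^sub>2, 1:])"
proof -
  let ?F = "map_poly to_ac f"
  have deg_F: "Polynomial.degree ?F = 3" using assms(2) by (simp add: degree_map_poly)
  have "(of_nat 3 :: 'a alg_closure) \<noteq> 0"
    using assms(1) by (intro char_ne_imp_ne_zero) auto
  moreover have "Polynomial.coeff ?F 3 \<noteq> 0"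
    using deg_F by (metis leading_coeff_0_iff degree_0 zero_neq_numeral)
  moreover have coeff: "Polynomial.coeff (pderiv ?F) 2 = 3 * Polynomial.coeff ?F 3"
    by (simp add: coeff_pderiv numeral_3_eq_3)
  ultimately have "Polynomial.coeff (pderiv ?F) 2 \<noteq> 0" by simp
  moreover have "Polynomial.degree (pderiv ?F) \<le> 2"
    using degree_pderiv_le[of ?F] deg_F by simp
  ultimately have deg: "Polynomial.degree (pderiv ?F) = 2"
    using le_degree le_antisym by blast
  have roots: "{z. poly (pderiv ?F) z = 0} = {\<gamma>\<^sub>1, \<gamma>\<^sub>2}"
    using assms(3) by (simp add: critical_points_def)
  have "pderiv ?F = Polynomial.smult (Polynomial.lead_coeff (pderiv ?F)) (\<Prod>x\<in>{\<gamma>\<^sub>1, \<gamma>\<^sub>2}. [:-x, 1:])"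
    using poly_eq_prod_roots[of "pderiv ?F"] deg assms(4) unfolding roots by fastforce
  then show ?thesis
    using assms(4) coeff by (simp add: deg deg_F)
qed

text \<open>
  Modulo the quadratic \<open>f'\<close> over \<open>K\<close>, every iterate of \<open>f\<close> is a linear polynomial over \<open>K\<close>.
  If that takes the same value at both roots of \<open>f'\<close>, it is constant.
\<close>

lemma iterates_linear_at_quadratic_roots:
  assumes "\<And>z. z \<in> Z \<Longrightarrow> z\<^sup>2 = to_ac d * z + to_ac e"
  shows "\<exists>u v. \<forall>z\<in>Z. (ac_map f ^^ n) z = to_ac u * z + to_ac v"
proof (induction n)
  case 0
  show ?case by (intro exI[of _ 1] exI[of _ 0]) simp
next
  case (Suc n)
  then obtain u v where uv: "\<forall>z\<in>Z. (ac_map f ^^ n) z = to_ac u * z + to_ac v" by blast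
  have "\<exists>a b. \<forall>z\<in>Z. poly (map_poly to_ac p) (to_ac u * z + to_ac v) = to_ac a * z + to_ac b" for p
  proof (induction p)
    case 0
    show ?case by (intro exI[of _ 0]) simp
  next
    case (pCons k p)
    then obtain a b where ab:
      "\<forall>z\<in>Z. poly (map_poly to_ac p) (to_ac u * z + to_ac v) = to_ac a * z + to_ac b" by blast
    show ?case
    proof (intro exI ballI)
      fix z assume z: "z \<in> Z"
      have "poly (map_poly to_ac (pCons k p)) (to_ac u * z + to_ac v) =
          to_ac k + (to_ac u * z + to_ac v) * (to_ac a * z + to_ac b)"
        using ab z by (simp add: map_poly_pCons)
      also have "\<dots> = to_ac (u * a) * z\<^sup>2 + to_ac (u * b + v * a) * z + to_ac (k + v * b)"
        by (simp add: algebra_simps power2_eq_square)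
      also have "\<dots> = to_ac (u * a * d + u * b + v * a) * z + to_ac (u * a * e + k + v * b)"
        unfolding assms[OF z] by (simp add: algebra_simps)
      finally show "poly (map_poly to_ac (pCons k p)) (to_ac u * z + to_ac v) =
        to_ac (u * a * d + u * b + v * a) * z + to_ac (u * a * e + k + v * b)" .
    qed
  qed
  from this[of f] show ?case using uv by (simp add: ac_map_def)
qed

text \<open>Solving \<open>f'(z) = 0\<close> for \<open>z\<^sup>2\<close> gives the required
  quadratic relation. The common value at two distinct critical points then annihilates the linear
  coefficient \<open>u\<close>.\<close>

lemma collision_value_in_base:
  fixes f :: "'a::field poly"
  assumes "CHAR('a) \<noteq> 3" "Polynomial.degree f = 3"
    and "critical_points f = {\<gamma>\<^sub>1, \<gamma>\<^sub>2}" "\<gamma>\<^sub>1 \<noteq> \<gamma>\<^sub>2"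
    and "(ac_map f ^^ n) \<gamma>\<^sub>1 = (ac_map f ^^ n) \<gamma>\<^sub>2"
  shows "(ac_map f ^^ n) \<gamma>\<^sub>1 \<in> range to_ac"
proof -
  let ?g = "pderiv f"
  define A where "A = Polynomial.coeff ?g 2"
  define B where "B = Polynomial.coeff ?g 1"
  define C where "C = Polynomial.coeff ?g 0"
  have deg: "Polynomial.degree ?g \<le> 2" using degree_pderiv_le[of f] assms(2) by simp
  have "Polynomial.coeff f 3 \<noteq> 0"
    using assms(2) by (metis leading_coeff_0_iff degree_0 zero_neq_numeral)
  moreover have "(of_nat 3 :: 'a) \<noteq> 0" using assms(1) by (intro char_ne_imp_ne_zero) auto
  ultimately have "A \<noteq> 0" by (simp add: A_def coeff_pderiv numeral_3_eq_3)
  have "?g = [:C, B, A:]"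
  proof (rule poly_eqI)
    fix i :: nat
    consider "i = 0" | "i = 1" | "i = 2" | "i > 2" by linarith
    then show "Polynomial.coeff ?g i = Polynomial.coeff [:C, B, A:] i"
      by cases (use deg in \<open>auto simp: A_def B_def C_def coeff_eq_0 numeral_2_eq_2 coeff_pCons split: nat.splits\<close>)
  qed
  then have g: "map_poly to_ac ?g = [:to_ac C, to_ac B, to_ac A:]"
    by (simp add: map_poly_pCons)
  have "z\<^sup>2 = to_ac (- B / A) * z + to_ac (- C / A)" if "z \<in> {\<gamma>\<^sub>1, \<gamma>\<^sub>2}" for z
  proof -
    have "poly (map_poly to_ac ?g) z = 0"
      using that assms(3) by (auto simp: critical_points_def pderiv_map_to_ac)
    then have "to_ac A * z\<^sup>2 = - to_ac B * z - to_ac C"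
      unfolding g by (simp add: algebra_simps power2_eq_square eq_neg_iff_add_eq_0)
    then have "z\<^sup>2 = (- to_ac B * z - to_ac C) / to_ac A"
      using \<open>A \<noteq> 0\<close> by (simp add: nonzero_eq_divide_eq mult.commute)
    then show ?thesis by (simp add: diff_divide_distrib)
  qed
  then obtain u v where uv: "\<forall>z\<in>{\<gamma>\<^sub>1, \<gamma>\<^sub>2}. (ac_map f ^^ n) z = to_ac u * z + to_ac v"
    using iterates_linear_at_quadratic_roots[of "{\<gamma>\<^sub>1, \<gamma>\<^sub>2}"] by blast
  then have "to_ac u * \<gamma>\<^sub>1 + to_ac v = to_ac u * \<gamma>\<^sub>2 + to_ac v"
    using assms(5) by (metis insertCI)
  then have "to_ac u * (\<gamma>\<^sub>1 - \<gamma>\<^sub>2) = 0" by (simp add: right_diff_distrib)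
  then have "u = 0" using assms(4) by simp
  then show ?thesis using uv by simp
qed

text \<open>The three preimages of each uncritical point are enumerated arbitrarily by
  \<open>h\<close>; a word is read from the root as a sequence of choices among them.\<close>

lemma (in cubic_arboreal) ex_word_points: "\<exists>\<nu>. word_points \<nu>"
proof -
  have "\<exists>h. uncritical F y \<longrightarrow> bij_betw h {0..<3::nat} (fiber (ac_map f) 1 y)" for y
    using ex_bij_betw_nat_finite[of "fiber (ac_map f) 1 y"] card_fiber[OF deg_F, of y 1] finite_fiber[OF deg_F, of 1 y]
    by (auto simp: poly_F)
  then obtain h where h: "\<And>y. uncritical F y \<Longrightarrow> bij_betw (h y) {0..<3::nat} (fiber (ac_map f) 1 y)"
    by metis
  define \<nu> where "\<nu> w = foldl h (to_ac x\<^sub>0) w" for w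
  have \<nu>_snoc: "\<nu> (q @ [i]) = h (\<nu> q) i" for q i by (simp add: \<nu>_def)
  have words_Suc: "w \<in> ternary_words (Suc n) \<Longrightarrow> \<exists>q i. w = q @ [i] \<and> q \<in> ternary_words n \<and> i < 3" for w n
    by (cases w rule: rev_cases) (auto simp: ternary_words_snoc, simp add: ternary_words_def)
  have bij: "bij_betw \<nu> (ternary_words n) (iter_preimage f x\<^sub>0 n)" for n
  proof (induction n)
    case 0
    then show ?case by (simp add: \<nu>_def bij_betw_def)
  next
    case (Suc n)
    have hq: "bij_betw (h (\<nu> q)) {0..<3} (fiber (ac_map f) 1 (\<nu> q))" if "q \<in> ternary_words n" for q
      using Suc that by (intro h uncritical_preimage[of _ n]) (auto simp: bij_betw_def)
    have f_h: "ac_map f (h (\<nu> q) i) = \<nu> q" if "q \<in> ternary_words n" "i < 3" for q i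
      using hq[OF that(1)] that(2) by (auto simp: bij_betw_def fiber_def)
    show ?case
      unfolding bij_betw_def
    proof
      show "inj_on \<nu> (ternary_words (Suc n))"
      proof (rule inj_onI)
        fix v w assume vw: "v \<in> ternary_words (Suc n)" "w \<in> ternary_words (Suc n)" "\<nu> v = \<nu> w"
        obtain q i r j where eq: "v = q @ [i]" "w = r @ [j]" "q \<in> ternary_words n" "r \<in> ternary_words n" "i < 3" "j < 3"
          using words_Suc[OF vw(1)] words_Suc[OF vw(2)] by blast
        have hh: "h (\<nu> q) i = h (\<nu> r) j" using vw(3) by (simp add: eq \<nu>_snoc)
        then have "\<nu> q = \<nu> r" using f_h eq by metis
        then have "q = r" using Suc eq by (auto simp: bij_betw_def dest: inj_onD)
        moreover have "i = j" using hh hq[OF eq(3)] eq \<open>q = r\<close> by (auto simp: bij_betw_def dest: inj_onD)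
        ultimately show "v = w" by (simp add: eq)
      qed
      show "\<nu> ` ternary_words (Suc n) = iter_preimage f x\<^sub>0 (Suc n)"
      proof
        show "\<nu> ` ternary_words (Suc n) \<subseteq> iter_preimage f x\<^sub>0 (Suc n)"
        proof (rule image_subsetI)
          fix w assume "w \<in> ternary_words (Suc n)"
          then obtain q i where eq: "w = q @ [i]" "q \<in> ternary_words n" "i < 3" using words_Suc by blast
          then show "\<nu> w \<in> iter_preimage f x\<^sub>0 (Suc n)"
            using Suc f_h by (auto simp: \<nu>_snoc iter_preimage_Suc bij_betw_def)
        qed
        show "iter_preimage f x\<^sub>0 (Suc n) \<subseteq> \<nu> ` ternary_words (Suc n)"
        proof
          fix y assume "y \<in> iter_preimage f x\<^sub>0 (Suc n)"
          then have "ac_map f y \<in> \<nu> ` ternary_words n"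
            using Suc by (simp add: iter_preimage_Suc bij_betw_def)
          then obtain q where q: "q \<in> ternary_words n" "ac_map f y = \<nu> q" by blast
          then have "y \<in> h (\<nu> q) ` {0..<3}" using hq[OF q(1)] by (simp add: bij_betw_def fiber_def)
          then obtain i where "i < 3" "y = h (\<nu> q) i" by auto
          then show "y \<in> \<nu> ` ternary_words (Suc n)"
            using q by (intro image_eqI[of _ _ "q @ [i]"]) (simp_all add: \<nu>_snoc ternary_words_snoc)
        qed
      qed
    qed
  qed
  have "ac_map f (\<nu> w) = \<nu> (butlast w)" if w: "w \<in> ternary_words (Suc n)" for n w
  proof -
    obtain q i where eq: "w = q @ [i]" "q \<in> ternary_words n" "i < 3" using words_Suc[OF w] by blast
    have "uncritical F (\<nu> q)"
      using bij[of n] eq by (intro uncritical_preimage[of _ n]) (auto simp: bij_betw_def)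
    then show ?thesis using h[of "\<nu> q"] eq by (auto simp: \<nu>_snoc bij_betw_def fiber_def)
  qed
  then show ?thesis using bij unfolding word_points_def by blast
qed

section \<open>Square roots of the two-level discriminant and the choice of the labeling\<close>

locale colliding_cubic = cubic_arboreal f x\<^sub>0
  for f :: "'a::field poly" and x\<^sub>0 :: 'a +
  fixes \<gamma>\<^sub>1 \<gamma>\<^sub>2 c :: "'a alg_closure" and l :: nat and s :: "'a alg_closure"
  assumes char2: "CHAR('a) \<noteq> 2" and char3: "CHAR('a) \<noteq> 3"
    and critical: "critical_points f = {\<gamma>\<^sub>1, \<gamma>\<^sub>2}" "\<gamma>\<^sub>1 \<noteq> \<gamma>\<^sub>2"
    and l: "l \<ge> 2"
    and collision: "(ac_map f ^^ l) \<gamma>\<^sub>1 = c" "(ac_map f ^^ l) \<gamma>\<^sub>2 = c"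
    and s: "s\<^sup>2 = -3"
begin

abbreviation ratio where "ratio \<equiv> level_ratio F (l - 1) c"

lemma two_ne_zero: "(2 :: 'a alg_closure) \<noteq> 0"
  using char_ne_imp_ne_zero[where ?'b = "'a alg_closure", of 2] char2 by simp

lemma s_ne_zero: "s \<noteq> 0"
  using char_ne_imp_ne_zero[where ?'b = "'a alg_closure", of 3] char3 s by auto

lemma two_levels_square:
  assumes "word_points \<nu>" "p \<in> ternary_words n"
  shows "(two_levels l \<nu> p)\<^sup>2 = (s * ratio (\<nu> p))\<^sup>2"
proof -
  have Suc_l: "Suc (l - 1) = l" using l by simp
  have \<nu>p: "\<nu> p \<in> iter_preimage f x\<^sub>0 n"
    using assms by (auto simp: word_points_def bij_betw_def)
  note square = vandermonde_two_levels_square[OF deg_F uncritical_preimage[OF \<nu>p]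
      pderiv_eq_critical_points[OF char3 deg_f critical], where m = "l - 1" and c = c,
      unfolded Suc_l poly_F]
  show ?thesis
    unfolding two_levels_def
    using square[OF collision word_points_fiber[OF assms] word_points_fiber[OF assms]]
    by (simp only: power_mult_distrib s)
qed

lemma two_levels_nonzero:
  assumes "word_points \<nu>" "p \<in> ternary_words n"
  shows "two_levels l \<nu> p \<noteq> 0"
proof -
  have "inj_on (\<lambda>s. \<nu> (p @ s)) (ternary_words m)" for m
    using word_points_fiber[OF assms] by (simp add: bij_betw_def)
  then show ?thesis by (simp add: two_levels_def vandermonde_nonzero)
qed

text \<open>Read off from any labeling: \<open>s * ratio y\<close> has the same square as a product
  of Vandermonde products of distinct points.\<close>

lemma ratio_nonzero:
  assumes "y \<in> iter_preimage f x\<^sub>0 n"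
  shows "ratio y \<noteq> 0"
proof -
  obtain \<nu> where \<nu>: "word_points \<nu>" using ex_word_points ..
  then have "y \<in> \<nu> ` ternary_words n"
    using assms by (simp add: word_points_def bij_betw_def)
  then obtain p where p: "p \<in> ternary_words n" "y = \<nu> p" by blast
  show ?thesis using two_levels_square[OF \<nu> p(1)] two_levels_nonzero[OF \<nu> p(1)] p(2) by auto
qed

text \<open>
  Swapping the two words \<open>p 0\<dots>00\<close> and \<open>p 0\<dots>01\<close> at level \<open>|p| + l\<close> corrects the sign at the
  node \<open>p\<close> without affecting any other node at its level or closer to the root.
\<close>

lemma correct_next_level:
  assumes \<nu>: "word_points \<nu>"
    and good: "\<And>k p. k + l \<le> n \<Longrightarrow> p \<in> ternary_words k \<Longrightarrow> two_levels l \<nu> p = s * ratio (\<nu> p)"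
  shows "\<exists>\<nu>'. word_points \<nu>' \<and>
    (\<forall>k p. k + l \<le> Suc n \<longrightarrow> p \<in> ternary_words k \<longrightarrow> two_levels l \<nu>' p = s * ratio (\<nu>' p)) \<and>
    (\<forall>w. length w \<le> n \<longrightarrow> \<nu>' w = \<nu> w)"
proof (cases "l \<le> Suc n")
  case False
  then show ?thesis using \<nu> by (intro exI[of _ \<nu>]) auto
next
  case True
  \<comment> \<open>The only new level: its products are the first to involve words of length
    \<open>Suc n\<close>.\<close>
  define k where "k = Suc n - l"
  have kl: "k + l = Suc n" using True by (simp add: k_def)
  define Bad where "Bad = {p \<in> ternary_words k. two_levels l \<nu> p \<noteq> s * ratio (\<nu> p)}"
  define a where "a = replicate (l - 1) (0::nat) @ [0]"
  define b where "b = replicate (l - 1) (0::nat) @ [1]"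
  have ab: "a \<in> ternary_words l" "b \<in> ternary_words l" "a \<noteq> b" "butlast a = butlast b"
    "length a = l" "length b = l"
    unfolding a_def b_def using l
    by (auto simp: ternary_words_def)
  define t where "t = transpose a b"
  have t_invol: "t (t v) = v" for v by (simp add: t_def)
  have t_len: "length (t v) = length v" for v
    using ab by (auto simp: t_def transpose_def)
  have t_words: "v \<in> ternary_words l \<Longrightarrow> t v \<in> ternary_words l" for v
    using ab by (auto simp: t_def transpose_def)
  have t_butlast: "butlast (t v) = butlast v" for v
    using ab by (auto simp: t_def transpose_def)
  \<comment> \<open>Below each bad node the swap carries along the whole subtrees, by keeping the
    tail of the word. As \<open>a\<close> and \<open>b\<close> are siblings, \<open>\<tau>\<close>
    respects parents.\<close>
  define \<tau> where "\<tau> w = (if length w \<ge> Suc n \<and> take k w \<in> Bad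
    then take k w @ t (take l (drop k w)) @ drop (Suc n) w else w)" for w
  have \<tau>_eq: "\<tau> (p @ v @ w) = p @ t v @ w" if "p \<in> Bad" "length p = k" "length v = l" for p v w
    using that kl by (simp add: \<tau>_def)
  have \<tau>_other: "\<tau> (p @ v) = p @ v" if "p \<notin> Bad" "length p = k" for p v
    using that by (simp add: \<tau>_def)
  have \<tau>_short: "\<tau> w = w" if "length w \<le> n" for w
    using that by (simp add: \<tau>_def)
  have split: "(\<exists>p v r. w = p @ v @ r \<and> length p = k \<and> length v = l)" if "length w \<ge> Suc n" for w
  proof (intro exI conjI)
    show "w = take k w @ take l (drop k w) @ drop l (drop k w)"
      by (simp only: append_take_drop_id)
  qed (use that kl in auto)
  have \<tau>_invol: "\<tau> (\<tau> w) = w" for w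
  proof (cases "length w \<ge> Suc n")
    case True
    then obtain p v r where w: "w = p @ v @ r" "length p = k" "length v = l" using split by blast
    then show ?thesis
      by (cases "p \<in> Bad") (simp_all add: \<tau>_eq \<tau>_other t_len t_invol)
  qed (simp add: \<tau>_short)
  have \<tau>_words: "\<tau> w \<in> ternary_words m" if "w \<in> ternary_words m" for w m
  proof (cases "length w \<ge> Suc n")
    case True
    then obtain p v r where w: "w = p @ v @ r" "length p = k" "length v = l" using split by blast
    have "v \<in> ternary_words l" using that w by (auto simp: ternary_words_def)
    then have "t v \<in> ternary_words l" by (rule t_words)
    then have "p @ t v @ r \<in> ternary_words m" using that w by (auto simp: ternary_words_def)
    then show ?thesis using that w by (cases "p \<in> Bad") (simp_all add: \<tau>_eq \<tau>_other)
  qed (use that in \<open>simp add: \<tau>_short\<close>)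
  have \<tau>_butlast: "butlast (\<tau> w) = \<tau> (butlast w)" for w
  proof (cases "length w \<ge> Suc n")
    case True
    then obtain p v r where w: "w = p @ v @ r" "length p = k" "length v = l" using split by blast
    show ?thesis
    proof (cases "r = []")
      \<comment> \<open>Here \<open>w\<close> has length exactly \<open>Suc n\<close>, and its
        parent is too short for \<open>\<tau>\<close> to move; the claim rests on
        \<open>butlast a = butlast b\<close>.\<close>
      case True
      have "v \<noteq> []" "t v \<noteq> []" using w t_len[of v] l by auto
      moreover have "length (p @ butlast v) \<le> n" using w kl l by simp
      ultimately show ?thesis
        using w True \<tau>_eq[of p v "[]"] \<tau>_other[of p v]
        by (cases "p \<in> Bad") (simp_all add: butlast_append t_butlast \<tau>_short)
    next
      case False
      then show ?thesis using w \<tau>_eq[of p v] \<tau>_other[of p "v @ _"]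
        by (cases "p \<in> Bad") (simp_all add: butlast_append)
    qed
  qed (simp add: \<tau>_short)
  define \<nu>' where "\<nu>' w = \<nu> (\<tau> w)" for w
  have wp: "word_points \<nu>'"
    unfolding word_points_def
  proof (intro conjI allI ballI)
    fix m
    have "bij_betw \<tau> (ternary_words m) (ternary_words m)"
      by (rule bij_betw_byWitness[of _ \<tau>]) (use \<tau>_invol \<tau>_words in auto)
    moreover have "bij_betw \<nu> (ternary_words m) (iter_preimage f x\<^sub>0 m)"
      using \<nu> by (simp add: word_points_def)
    ultimately show "bij_betw \<nu>' (ternary_words m) (iter_preimage f x\<^sub>0 m)"
      using bij_betw_trans[of \<tau> _ _ \<nu>] by (simp add: \<nu>'_def[abs_def] comp_def)
    show "ac_map f (\<nu>' w) = \<nu>' (butlast w)" if "w \<in> ternary_words (Suc m)" for w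
      using \<nu> \<tau>_words[OF that] by (simp add: word_points_def \<nu>'_def \<tau>_butlast)
  qed
  have low: "\<nu>' w = \<nu> w" if "length w \<le> n" for w using that by (simp add: \<nu>'_def \<tau>_short)
  have "two_levels l \<nu>' p = s * ratio (\<nu>' p)" if p: "j + l \<le> Suc n" "p \<in> ternary_words j" for j p
  proof -
    have len_p: "length p = j" "length p \<le> n" using p l by (auto simp: ternary_words_def)
    have lower: "vandermonde (\<lambda>v. \<nu>' (p @ v)) (ternary_words m) = vandermonde (\<lambda>v. \<nu> (p @ v)) (ternary_words m)"
      if "j + m \<le> n" for m
      using that len_p by (intro vandermonde_cong low) (auto simp: ternary_words_def)
    show ?thesis
    proof (cases "j + l \<le> n")
      case True
      then show ?thesis
        using good[OF True p(2)] lower[of l] lower[of "l - 1"] low[OF len_p(2)]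
        by (simp add: two_levels_def)
    next
      case False
      then have "j = k" using p(1) kl by simp
      have below: "vandermonde (\<lambda>v. \<nu>' (p @ v)) (ternary_words (l - 1)) = vandermonde (\<lambda>v. \<nu> (p @ v)) (ternary_words (l - 1))"
        using p(1) l by (intro lower) auto
      show ?thesis
      proof (cases "p \<in> Bad")
        case True
        have "vandermonde (\<lambda>v. \<nu>' (p @ v)) (ternary_words l) = vandermonde (\<lambda>v. \<nu> (p @ t v)) (ternary_words l)"
        proof (rule vandermonde_cong)
          fix v assume "v \<in> ternary_words l"
          then show "\<nu>' (p @ v) = \<nu> (p @ t v)"
            using \<tau>_eq[OF True, of v "[]"] len_p \<open>j = k\<close> by (simp add: \<nu>'_def ternary_words_def)
        qed
        also have "\<dots> = - vandermonde (\<lambda>v. \<nu> (p @ v)) (ternary_words l)"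
          unfolding t_def using ab by (intro vandermonde_transpose) auto
        finally have "two_levels l \<nu>' p = - two_levels l \<nu> p"
          unfolding two_levels_def below by simp
        moreover have "two_levels l \<nu> p = - (s * ratio (\<nu> p))"
          using two_levels_square[OF \<nu> p(2)] True by (auto simp: Bad_def power2_eq_iff)
        ultimately show ?thesis by (simp add: low[OF len_p(2)])
      next
        case False
        have "vandermonde (\<lambda>v. \<nu>' (p @ v)) (ternary_words l) = vandermonde (\<lambda>v. \<nu> (p @ v)) (ternary_words l)"
          using \<tau>_other[OF False] len_p \<open>j = k\<close> by (intro vandermonde_cong) (simp add: \<nu>'_def)
        then have "two_levels l \<nu>' p = two_levels l \<nu> p"
          unfolding two_levels_def below by simp
        then show ?thesis using False p(2) \<open>j = k\<close> by (simp add: Bad_def low[OF len_p(2)])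
      qed
    qed
  qed
  then show ?thesis using wp low by blast
qed

text \<open>The step from stage \<open>n\<close> to the next leaves words of length at most
  \<open>n\<close> alone, so each word is final from the stage equal to its length on. The sign at a
  node of level \<open>k\<close> is decided at stage \<open>k + l\<close>.\<close>

lemma ex_good_word_points:
  "\<exists>\<nu>. word_points \<nu> \<and> (\<forall>k. \<forall>p\<in>ternary_words k. two_levels l \<nu> p = s * ratio (\<nu> p))"
proof -
  define P where "P n \<nu> \<longleftrightarrow> word_points \<nu> \<and>
    (\<forall>k p. k + l \<le> n \<longrightarrow> p \<in> ternary_words k \<longrightarrow> two_levels l \<nu> p = s * ratio (\<nu> p))" for n \<nu>
  have "\<exists>N. \<forall>n. P n (N n) \<and> (\<forall>w. length w \<le> n \<longrightarrow> N (Suc n) w = N n w)"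
  proof (rule dependent_nat_choice)
    \<comment> \<open>The sign condition is vacuous at stage 0 because \<open>l\<close> is
      positive.\<close>
    show "\<exists>\<nu>. P 0 \<nu>" using ex_word_points l by (auto simp: P_def)
    show "\<exists>\<nu>'. P (Suc n) \<nu>' \<and> (\<forall>w. length w \<le> n \<longrightarrow> \<nu>' w = \<nu> w)" if "P n \<nu>" for \<nu> n
      using correct_next_level[of \<nu> n] that unfolding P_def by blast
  qed
  then obtain N where N: "\<And>n. P n (N n)" and step: "\<And>n w. length w \<le> n \<Longrightarrow> N (Suc n) w = N n w"
    by blast
  have stable: "N n w = N (length w) w" if "length w \<le> n" for n w
    using that by (induction n rule: dec_induct) (simp_all add: step)
  define \<nu> where "\<nu> w = N (length w) w" for w
  have \<nu>: "\<nu> w = N n w" if "length w \<le> n" for w n using stable[OF that] by (simp add: \<nu>_def)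
  have wp: "word_points (N n)" for n using N by (simp add: P_def)
  have "word_points \<nu>"
    unfolding word_points_def
  proof (intro conjI allI ballI)
    show "bij_betw \<nu> (ternary_words n) (iter_preimage f x\<^sub>0 n)" for n
      using wp[of n] bij_betw_cong[of "ternary_words n" \<nu> "N n"] \<nu>
      by (simp add: word_points_def ternary_words_def)
    show "ac_map f (\<nu> q) = \<nu> (butlast q)" if "q \<in> ternary_words (Suc n)" for n q
    proof -
      have "\<nu> q = N (Suc n) q" "\<nu> (butlast q) = N (Suc n) (butlast q)"
        using that by (auto intro!: \<nu> simp: ternary_words_def)
      then show ?thesis using wp[of "Suc n"] that by (simp add: word_points_def)
    qed
  qed
  moreover have "two_levels l \<nu> p = s * ratio (\<nu> p)" if "p \<in> ternary_words k" for p k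
  proof -
    have "vandermonde (\<lambda>v. \<nu> (p @ v)) (ternary_words m) = vandermonde (\<lambda>v. N (k + l) (p @ v)) (ternary_words m)"
      if "m \<le> l" for m
      using that \<open>p \<in> ternary_words k\<close> by (intro vandermonde_cong \<nu>) (auto simp: ternary_words_def)
    then have "two_levels l \<nu> p = two_levels l (N (k + l)) p"
      by (simp add: two_levels_def)
    also have "\<dots> = s * ratio (N (k + l) p)" using N[of "k + l"] that order_refl unfolding P_def by blast
    also have "N (k + l) p = \<nu> p" using that by (intro \<nu>[symmetric]) (simp add: ternary_words_def)
    finally show ?thesis .
  qed
  ultimately show ?thesis by blast
qed

lemma ex_good_labeling:
  "\<exists>lab. tree_labeling T lab \<and> (\<forall>n. \<forall>y\<in>iter_preimage f x\<^sub>0 n.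
     two_levels l (\<lambda>w. snd (node_of_label T lab w)) (lab (n, y)) = s * ratio y)"
proof -
  obtain \<nu> where \<nu>: "word_points \<nu>"
    and good: "\<And>k p. p \<in> ternary_words k \<Longrightarrow> two_levels l \<nu> p = s * ratio (\<nu> p)"
    using ex_good_word_points by blast
  have bij: "bij_betw \<nu> (ternary_words n) (iter_preimage f x\<^sub>0 n)" for n
    using \<nu> by (simp add: word_points_def)
  define lab where "lab v = inv_into (ternary_words (fst v)) \<nu> (snd v)" for v
  have lab_words: "lab (n, y) \<in> ternary_words n" and \<nu>_lab: "\<nu> (lab (n, y)) = y"
    if "y \<in> iter_preimage f x\<^sub>0 n" for n y
    using bij[of n] that by (auto simp: lab_def bij_betw_def inv_into_into f_inv_into_f)
  have lab_\<nu>: "lab (n, \<nu> w) = w" if "w \<in> ternary_words n" for n w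
    using bij[of n] that by (simp add: lab_def bij_betw_def)
  have \<nu>_pre: "\<nu> w \<in> iter_preimage f x\<^sub>0 n" if "w \<in> ternary_words n" for n w
    using bij[of n] that by (auto simp: bij_betw_def)
  have lab: "tree_labeling T lab"
    unfolding tree_labeling_def
  proof (intro conjI allI ballI impI)
    show "bij_betw lab {v \<in> tree_nodes T. tree_level T v = n} (ternary_words n)" for n
      by (rule bij_betw_byWitness[of _ "\<lambda>w. (n, \<nu> w)"])
        (auto simp: lab_words \<nu>_lab lab_\<nu> \<nu>_pre)
    fix v assume v: "v \<in> tree_nodes T" "v \<noteq> tree_root T"
    obtain n y where eq: "v = (n, y)" by (cases v)
    with v have "n \<noteq> 0" by (cases n) auto
    then obtain m where m: "n = Suc m" using not0_implies_Suc by blast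
    have y: "y \<in> iter_preimage f x\<^sub>0 (Suc m)" using v eq m by simp
    have "ac_map f (\<nu> (lab (Suc m, y))) = \<nu> (butlast (lab (Suc m, y)))"
      using \<nu> lab_words[OF y] by (simp add: word_points_def)
    then have "ac_map f y = \<nu> (butlast (lab (Suc m, y)))" by (simp add: \<nu>_lab[OF y])
    then show "lab (tree_parent T v) = butlast (lab v)"
      using lab_\<nu>[OF ternary_words_butlast[OF lab_words[OF y]]] by (simp add: eq m)
  qed
  have node: "snd (node_of_label T lab w) = \<nu> w" if "w \<in> ternary_words n" for w n
    using tree_labeling_node(1)[OF lab, of "(n, \<nu> w)"] \<nu>_pre[OF that] lab_\<nu>[OF that] by simp
  have "two_levels l (\<lambda>w. snd (node_of_label T lab w)) (lab (n, y)) = s * ratio y"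
    if y: "y \<in> iter_preimage f x\<^sub>0 n" for n y
  proof -
    have "vandermonde (\<lambda>v. snd (node_of_label T lab (lab (n, y) @ v))) (ternary_words m) =
        vandermonde (\<lambda>v. \<nu> (lab (n, y) @ v)) (ternary_words m)" for m
      by (intro vandermonde_cong node[of _ "n + m"] ternary_words_append lab_words y)
    then show ?thesis
      using good[OF lab_words[OF y]] by (simp add: two_levels_def \<nu>_lab[OF y])
  qed
  then show ?thesis using lab by blast
qed

end

section \<open>Galois action on the ratio and on the sign products\<close>

context colliding_cubic
begin

lemma lead_coeff_iter_poly_in_base: "Polynomial.lead_coeff (iter_poly F k) \<in> range to_ac"
proof (induction k)
  case 0
  show ?case by (simp add: range_eqI[of _ _ 1])
next
  case (Suc k)
  then obtain a where a: "Polynomial.lead_coeff (iter_poly F k) = to_ac a" by blast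
  have "Polynomial.lead_coeff F = to_ac (Polynomial.lead_coeff f)"
    by (simp add: degree_map_poly coeff_map_poly)
  then have "Polynomial.lead_coeff (iter_poly F (Suc k)) = to_ac (Polynomial.lead_coeff f * a ^ 3)"
    unfolding lead_coeff_iter_poly_Suc[OF deg_F] a by simp
  then show ?case by blast
qed

lemma c_in_base: "c \<in> range to_ac"
  using collision_value_in_base[OF char3 deg_f critical, of l] collision by simp

text \<open>The fiber over \<open>y\<close> is carried onto the fiber over
  \<open>\<sigma> y\<close>, and all other ingredients are \<open>y\<close> and constants of
  \<open>K\<close>; \<open>c_in_base\<close> enters here. The set \<open>M\<close> is
  \<open>L\<close> for Galois elements and the closure for the extended conjugation.\<close>

lemma hom_ratio:
  assumes hom: "base_hom M \<sigma>" and inj: "inj_on \<sigma> M"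
    and sub: "\<And>n. iter_preimage f x\<^sub>0 n \<subseteq> M" and y: "y \<in> iter_preimage f x\<^sub>0 n"
  shows "\<sigma> (ratio y) = ratio (\<sigma> y)" and "ratio y \<in> M"
proof -
  interpret base_hom M \<sigma> by fact
  define m where "m = l - 1"
  have yM: "y \<in> M" using sub y by blast
  have y': "\<sigma> y \<in> iter_preimage f x\<^sub>0 n" by (rule hom_preimage[OF hom y yM])
  define S where "S u = fiber (ac_map f) m u" for u
  have S_pre: "S y \<subseteq> iter_preimage f x\<^sub>0 (n + m)"
    using y by (auto simp: S_def fiber_def iter_preimage_def funpow_add)
  then have S_M: "S y \<subseteq> M" using sub by blast
  have "\<sigma> ` S y \<subseteq> S (\<sigma> y)"
    using S_M by (auto simp: S_def fiber_def hom_iter[symmetric])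
  moreover have inj_S: "inj_on \<sigma> (S y)" using inj S_M by (rule inj_on_subset)
  \<comment> \<open>Both fibers have \<open>3 ^ m\<close> points, which makes the injection
    onto.\<close>
  moreover have "card (S (\<sigma> y)) = card (S y)" "finite (S (\<sigma> y))"
    unfolding S_def poly_F[symmetric]
    using card_fiber[OF deg_F uncritical_preimage[OF y]] card_fiber[OF deg_F uncritical_preimage[OF y']]
      finite_fiber[OF deg_F] by simp_all
  ultimately have image_S: "\<sigma> ` S y = S (\<sigma> y)"
    by (intro card_subset_eq) (simp_all add: card_image)
  define g where "g w = (\<Prod>i<m. poly (map_poly to_ac (pderiv f)) ((ac_map f ^^ i) w))" for w
  have g_mem: "g w \<in> M" if "w \<in> M" for w
    unfolding g_def using that by (intro prod_mem poly_mem iter_mem)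
  have hom_g: "\<sigma> (g w) = g (\<sigma> w)" if "w \<in> M" for w
    unfolding g_def using that
    by (subst hom_prod) (auto simp: hom_poly hom_iter iter_mem intro!: poly_mem)
  have D: "fiber_multiplier F m u = prod g (S u)" for u
    by (simp add: fiber_multiplier_def g_def S_def pderiv_map_to_ac poly_F)
  have D_mem: "prod g (S y) \<in> M" using S_M by (intro prod_mem g_mem) blast
  have "\<sigma> (prod g (S y)) = (\<Prod>w\<in>S y. \<sigma> (g w))"
    using S_M by (intro hom_prod g_mem) blast
  also have "\<dots> = (\<Prod>w\<in>S y. g (\<sigma> w))" using S_M by (intro prod.cong) (auto simp: hom_g)
  also have "\<dots> = prod g (S (\<sigma> y))"
    unfolding image_S[symmetric] by (simp add: prod.reindex[OF inj_S])
  finally have hom_D: "\<sigma> (prod g (S y)) = prod g (S (\<sigma> y))" .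
  obtain a b d where abd: "Polynomial.lead_coeff (iter_poly F m) = to_ac a"
    "Polynomial.lead_coeff (iter_poly F (Suc m)) = to_ac b" "c = to_ac d"
    using lead_coeff_iter_poly_in_base c_in_base by (metis rangeE)
  \<comment> \<open>Gathering the constants into one scalar of \<open>K\<close> leaves a polynomial
    expression, so no division has to be transported by \<open>\<sigma>\<close>.\<close>
  define k where "k = 3 ^ ((3 ^ Suc m - 1) div 2) / (a ^ (5 * 3 ^ m) * b)"
  have ratio: "ratio u = to_ac k * ((to_ac d - u) * (prod g (S u) * prod g (S u)))" for u
    unfolding level_ratio_def m_def[symmetric] abd D k_def by (simp add: power2_eq_square)
  note mem = mult_mem diff_mem base_mem D_mem yM
  show "\<sigma> (ratio y) = ratio (\<sigma> y)"
    unfolding ratio by (simp add: hom_mult hom_diff hom_base hom_D mem)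
  show "ratio y \<in> M" unfolding ratio by (intro mem)
qed

context
  fixes \<sigma> assumes \<sigma>: "\<sigma> \<in> arboreal_galois_group f x\<^sub>0"
begin

lemma galois_hom: "base_hom L \<sigma>" and galois_inj: "inj_on \<sigma> L"
  using \<sigma> by (auto simp: arboreal_galois_group_iff Bij_def bij_betw_def)

lemma galois_ratio:
  assumes "y \<in> iter_preimage f x\<^sub>0 n"
  shows "\<sigma> (ratio y) = ratio (\<sigma> y)" "ratio y \<in> L" "\<sigma> y \<in> iter_preimage f x\<^sub>0 n"
proof -
  have "iter_preimage f x\<^sub>0 k \<subseteq> L" for k using preimage_mem_L by blast
  note * = hom_ratio[OF galois_hom galois_inj this assms]
  show "\<sigma> (ratio y) = ratio (\<sigma> y)" "ratio y \<in> L" by (fact *)+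
  show "\<sigma> y \<in> iter_preimage f x\<^sub>0 n"
    by (rule hom_preimage[OF galois_hom assms preimage_mem_L[OF assms]])
qed

end

definition sign_product :: "(nat \<times> 'a alg_closure \<Rightarrow> nat list) \<Rightarrow> ('a alg_closure \<Rightarrow> 'a alg_closure) \<Rightarrow>
    nat \<times> 'a alg_closure \<Rightarrow> int" where
  "sign_product lab \<sigma> v = tree_sgn T lab l (arboreal_action f x\<^sub>0 \<sigma>) v *
     tree_sgn T lab (l - 1) (arboreal_action f x\<^sub>0 \<sigma>) v"

text \<open>Signs are integers, whereas the equations for them hold in the closure; characteristic
  other than 2 keeps 1 and -1 apart there.\<close>

lemma sign_product_eq_iff:
  "sign_product lab \<sigma> v = sign_product lab \<sigma> w \<longleftrightarrow>
    (of_int (sign_product lab \<sigma> v) :: 'a alg_closure) = of_int (sign_product lab \<sigma> w)"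
  and sign_product_eq_1_iff:
  "sign_product lab \<sigma> v = 1 \<longleftrightarrow> (of_int (sign_product lab \<sigma> v) :: 'a alg_closure) = 1"
proof -
  have sgn: "tree_sgn T lab k \<tau> v = 1 \<or> tree_sgn T lab k \<tau> v = -1" for k \<tau> v
    unfolding tree_sgn_def sign_def by simp
  have pm: "sign_product lab \<sigma> v = 1 \<or> sign_product lab \<sigma> v = -1" for v
    unfolding sign_product_def
    using sgn[of l "arboreal_action f x\<^sub>0 \<sigma>" v] sgn[of "l - 1" "arboreal_action f x\<^sub>0 \<sigma>" v]
    by (elim disjE) simp_all
  have "(1 :: 'a alg_closure) \<noteq> -1" using two_ne_zero by (metis add.right_inverse one_add_one)
  then have ne: "(1 :: 'a alg_closure) \<noteq> -1" "(-1 :: 'a alg_closure) \<noteq> 1" by metis+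
  show "sign_product lab \<sigma> v = sign_product lab \<sigma> w \<longleftrightarrow>
    (of_int (sign_product lab \<sigma> v) :: 'a alg_closure) = of_int (sign_product lab \<sigma> w)"
    using pm[of v] pm[of w] ne by auto
  show "sign_product lab \<sigma> v = 1 \<longleftrightarrow> (of_int (sign_product lab \<sigma> v) :: 'a alg_closure) = 1"
    using pm[of v] ne by auto
qed

lemma ball_tree_nodes: "(\<forall>v\<in>tree_nodes T. P v) \<longleftrightarrow> (\<forall>n. \<forall>y\<in>iter_preimage f x\<^sub>0 n. P (n, y))"
  by (auto simp: backward_orbit_tree_def)

lemma Q_tilde_iff:
  assumes "\<sigma> \<in> arboreal_galois_group f x\<^sub>0"
  shows "arboreal_action f x\<^sub>0 \<sigma> \<in> Q_tilde T lab l \<longleftrightarrow>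
    (\<forall>n. \<forall>y\<in>iter_preimage f x\<^sub>0 n. sign_product lab \<sigma> (n, y) = sign_product lab \<sigma> (0, to_ac x\<^sub>0))"
  unfolding Q_tilde_def ball_tree_nodes mem_Collect_eq tree_simps(1)
  unfolding sign_product_def[symmetric]
  using arboreal_action_automorphism[OF assms] by blast

lemma Q_group_iff:
  assumes "\<sigma> \<in> arboreal_galois_group f x\<^sub>0"
  shows "arboreal_action f x\<^sub>0 \<sigma> \<in> Q_group T lab l \<longleftrightarrow>
    (\<forall>n. \<forall>y\<in>iter_preimage f x\<^sub>0 n. sign_product lab \<sigma> (n, y) = 1)"
proof -
  have "to_ac x\<^sub>0 \<in> iter_preimage f x\<^sub>0 0" by simp
  then show ?thesis
    unfolding Q_group_def mem_Collect_eq Q_tilde_iff[OF assms] tree_simps(1)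
    unfolding sign_product_def[symmetric] by metis
qed

lemma good_labeling_sign:
  assumes lab: "tree_labeling T lab"
    and good: "\<forall>n. \<forall>y\<in>iter_preimage f x\<^sub>0 n.
      two_levels l (\<lambda>w. snd (node_of_label T lab w)) (lab (n, y)) = s * ratio y"
    and \<sigma>: "\<sigma> \<in> arboreal_galois_group f x\<^sub>0" and y: "y \<in> iter_preimage f x\<^sub>0 n"
  shows "\<sigma> (s * ratio y) = of_int (sign_product lab \<sigma> (n, y)) * (s * ratio (\<sigma> y))"
    and "s * ratio y \<in> L"
  using hom_two_levels[OF lab galois_hom[OF \<sigma>] galois_inj[OF \<sigma>] y, of l]
    good[rule_format, OF y] good[rule_format, OF galois_ratio(3)[OF \<sigma> y]]
  by (simp_all add: sign_product_def)

theorem galois_in_Q_tilde: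
  "\<exists>lab. tree_labeling T lab \<and>
    arboreal_action f x\<^sub>0 ` arboreal_galois_group f x\<^sub>0 \<subseteq> Q_tilde T lab l"
proof -
  obtain lab where lab: "tree_labeling T lab"
    and good: "\<forall>n. \<forall>y\<in>iter_preimage f x\<^sub>0 n.
      two_levels l (\<lambda>w. snd (node_of_label T lab w)) (lab (n, y)) = s * ratio y"
    using ex_good_labeling by blast
  have "arboreal_action f x\<^sub>0 \<sigma> \<in> Q_tilde T lab l" if \<sigma>: "\<sigma> \<in> arboreal_galois_group f x\<^sub>0" for \<sigma>
    unfolding Q_tilde_iff[OF \<sigma>]
  proof (intro allI ballI)
    fix n y assume y: "y \<in> iter_preimage f x\<^sub>0 n"
    interpret base_hom L \<sigma> by (rule galois_hom[OF \<sigma>])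
    let ?x = "to_ac x\<^sub>0"
    have x: "?x \<in> iter_preimage f x\<^sub>0 0" by simp
    note sign = good_labeling_sign[OF lab good \<sigma>] and ratio = galois_ratio[OF \<sigma>]
    \<comment> \<open>The quotient \<open>\<sigma>(s) / s\<close> is avoided, since \<open>s\<close>
      has not been placed in \<open>L\<close>. Instead one element of \<open>L\<close> is grouped in
      two ways into factors known to lie in \<open>L\<close>; \<open>?x\<close> comes from
      \<open>K\<close> and is fixed.\<close>
    have "\<sigma> (s * ratio y * ratio ?x) = \<sigma> (s * ratio ?x * ratio y)" by (simp only: mult_ac)
    then have "of_int (sign_product lab \<sigma> (n, y)) * (s * ratio (\<sigma> y)) * ratio ?x =
        of_int (sign_product lab \<sigma> (0, ?x)) * (s * ratio ?x) * ratio (\<sigma> y)"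
      using sign[OF y] sign[OF x] ratio[OF y] ratio[OF x] hom_base[of x\<^sub>0]
      by (simp only: hom_mult)
    then have "of_int (sign_product lab \<sigma> (n, y)) * (s * ratio (\<sigma> y) * ratio ?x) =
        of_int (sign_product lab \<sigma> (0, ?x)) * (s * ratio (\<sigma> y) * ratio ?x)"
      by (simp only: mult_ac)
    moreover have "s * ratio (\<sigma> y) * ratio ?x \<noteq> 0"
      using s_ne_zero ratio_nonzero[OF x] ratio_nonzero[OF ratio(3)[OF y]] by simp
    ultimately show "sign_product lab \<sigma> (n, y) = sign_product lab \<sigma> (0, ?x)"
      unfolding sign_product_eq_iff[of lab \<sigma> "(n, y)"] by (metis mult_right_cancel)
  qed
  then show ?thesis using lab by blast
qed

text \<open>The labeling for \<open>Q_tilde\<close> already works: when \<open>s\<close> is in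
  \<open>K\<close>, \<open>\<sigma>\<close> sends \<open>s * ratio y\<close> to
  \<open>s * ratio (\<sigma> y)\<close>, which leaves only the sign 1.\<close>

theorem galois_in_Q_group_of_base:
  assumes "s \<in> range to_ac"
  shows "\<exists>lab. tree_labeling T lab \<and>
    arboreal_action f x\<^sub>0 ` arboreal_galois_group f x\<^sub>0 \<subseteq> Q_group T lab l"
proof -
  obtain lab where lab: "tree_labeling T lab"
    and good: "\<forall>n. \<forall>y\<in>iter_preimage f x\<^sub>0 n.
      two_levels l (\<lambda>w. snd (node_of_label T lab w)) (lab (n, y)) = s * ratio y"
    using ex_good_labeling by blast
  have "arboreal_action f x\<^sub>0 \<sigma> \<in> Q_group T lab l" if \<sigma>: "\<sigma> \<in> arboreal_galois_group f x\<^sub>0" for \<sigma>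
    unfolding Q_group_iff[OF \<sigma>]
  proof (intro allI ballI)
    fix n y assume y: "y \<in> iter_preimage f x\<^sub>0 n"
    interpret base_hom L \<sigma> by (rule galois_hom[OF \<sigma>])
    note ratio = galois_ratio[OF \<sigma> y]
    have "\<sigma> (s * ratio y) = s * ratio (\<sigma> y)"
      using assms ratio base_mem by (auto simp: hom_mult hom_base)
    then have "of_int (sign_product lab \<sigma> (n, y)) * (s * ratio (\<sigma> y)) = 1 * (s * ratio (\<sigma> y))"
      using good_labeling_sign(1)[OF lab good \<sigma> y] by simp
    moreover have "s * ratio (\<sigma> y) \<noteq> 0" using s_ne_zero ratio_nonzero[OF ratio(3)] by simp
    ultimately show "sign_product lab \<sigma> (n, y) = 1"
      unfolding sign_product_eq_1_iff by (metis mult_right_cancel)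
  qed
  then show ?thesis using lab by blast
qed

text \<open>At the root \<open>?V\<close> is plus or minus \<open>s * ratio ?x\<close> for any
  labeling, and which sign occurs is immaterial: membership in \<open>Q_group\<close> makes
  \<open>\<rho>\<close> fix \<open>?V\<close>, whereas conjugation of \<open>s\<close> negates
  it.\<close>

theorem base_of_galois_in_Q_group:
  assumes lab: "tree_labeling T lab"
    and Q: "arboreal_action f x\<^sub>0 ` arboreal_galois_group f x\<^sub>0 \<subseteq> Q_group T lab l"
  shows "s \<in> range to_ac"
proof (rule ccontr)
  assume "s \<notin> range to_ac"
  moreover have "s\<^sup>2 = to_ac (-3)" by (simp add: s)
  ultimately obtain \<rho> where \<rho>: "base_hom UNIV \<rho>" "\<rho> s = - s"
    using exists_conjugation by blast
  interpret \<rho>: base_hom UNIV \<rho> by (rule \<rho>(1))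
  define \<sigma> where "\<sigma> = restrict \<rho> L"
  have \<sigma>: "\<sigma> \<in> arboreal_galois_group f x\<^sub>0"
    unfolding \<sigma>_def by (rule restrict_mem_galois_group[OF \<rho>(1)])
  interpret base_hom L \<sigma> by (rule galois_hom[OF \<sigma>])
  define \<nu> where "\<nu> = (\<lambda>w. snd (node_of_label T lab w))"
  let ?x = "to_ac x\<^sub>0"
  let ?V = "two_levels l \<nu> (lab (0, ?x))"
  have x: "?x \<in> iter_preimage f x\<^sub>0 0" by simp
  have wp: "word_points \<nu>" unfolding \<nu>_def by (rule word_points_of_labeling[OF lab])
  have p: "lab (0, ?x) \<in> ternary_words 0" "\<nu> (lab (0, ?x)) = ?x"
    using tree_labeling_node[OF lab, of "(0, ?x)"] x by (simp_all add: \<nu>_def)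
  have "sign_product lab \<sigma> (0, ?x) = 1"
    using Q \<sigma> Q_group_iff[OF \<sigma>, of lab] x by blast
  then have "\<sigma> ?V = ?V" "?V \<in> L"
    using hom_two_levels[OF lab galois_hom[OF \<sigma>] galois_inj[OF \<sigma>] x, of l] hom_base[of x\<^sub>0]
    unfolding \<nu>_def sign_product_def by simp_all
  then have fixed: "\<rho> ?V = ?V" by (simp add: \<sigma>_def)
  have ratio: "\<rho> (ratio ?x) = ratio ?x"
    using hom_ratio(1)[OF \<rho>(1) base_hom_UNIV_inj[OF \<rho>(1)] subset_UNIV x] \<rho>.hom_base[of x\<^sub>0] by simp
  have "\<rho> (s * ratio ?x) = - (s * ratio ?x)"
    using \<rho>.hom_mult[of s "ratio ?x"] \<rho>(2) ratio by simp
  moreover have "?V = s * ratio ?x \<or> ?V = - (s * ratio ?x)"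
    using two_levels_square[OF wp p(1)] unfolding p(2) power2_eq_iff .
  ultimately have "\<rho> ?V = - ?V"
    using base_hom_UNIV_minus[OF \<rho>(1)] by auto
  with fixed have "2 * ?V = 0" by (metis add.right_inverse mult_2)
  then show False using two_ne_zero two_levels_nonzero[OF wp p(1)] by simp
qed

end

theorem theorem1p2:
  fixes f :: "'a::field poly"
    and \<gamma>\<^sub>1 \<gamma>\<^sub>2 :: "'a alg_closure"
    and l :: nat
  assumes "CHAR('a) \<noteq> 2" and "CHAR('a) \<noteq> 3"
    and "Polynomial.degree f = 3"
    and "critical_points f = {\<gamma>\<^sub>1, \<gamma>\<^sub>2}"
    and "l \<ge> 2"
    and "(ac_map f ^^ l) \<gamma>\<^sub>1 = (ac_map f ^^ l) \<gamma>\<^sub>2"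
    and "(ac_map f ^^ (l - 1)) \<gamma>\<^sub>1 \<noteq> (ac_map f ^^ (l - 1)) \<gamma>\<^sub>2"
  shows "(ac_map f ^^ l) \<gamma>\<^sub>1 \<in> range to_ac \<and>
    (\<forall>x\<^sub>0 :: 'a.
       \<not> periodic (poly f) x\<^sub>0 \<longrightarrow>
       (\<forall>n. critical_points f \<inter> iter_preimage f x\<^sub>0 n = {}) \<longrightarrow>
       (\<exists>lab. tree_labeling (backward_orbit_tree f x\<^sub>0) lab \<and>
          arboreal_action f x\<^sub>0 ` arboreal_galois_group f x\<^sub>0
            \<subseteq> Q_tilde (backward_orbit_tree f x\<^sub>0) lab l) \<and>
       ((\<exists>lab. tree_labeling (backward_orbit_tree f x\<^sub>0) lab \<and>
          arboreal_action f x\<^sub>0 ` arboreal_galois_group f x\<^sub>0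
            \<subseteq> Q_group (backward_orbit_tree f x\<^sub>0) lab l)
        \<longleftrightarrow> (\<exists>s :: 'a. s ^ 2 = - 3)))"
proof (intro conjI allI impI)
  have ne: "\<gamma>\<^sub>1 \<noteq> \<gamma>\<^sub>2" using assms(7) by auto
  show "(ac_map f ^^ l) \<gamma>\<^sub>1 \<in> range to_ac"
    by (rule collision_value_in_base[OF assms(2,3,4) ne assms(6)])
  fix x\<^sub>0 :: 'a
  assume noncritical: "\<forall>n. critical_points f \<inter> iter_preimage f x\<^sub>0 n = {}"
  have "\<exists>s. s ^ 2 = (-3 :: 'a alg_closure)" using nth_root_exists[of 2 "-3"] by auto
  then obtain s :: "'a alg_closure" where s: "s\<^sup>2 = -3" ..
  interpret colliding_cubic f x\<^sub>0 \<gamma>\<^sub>1 \<gamma>\<^sub>2 "(ac_map f ^^ l) \<gamma>\<^sub>1" l s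
    by unfold_locales (use assms ne noncritical s in auto)
  show "\<exists>lab. tree_labeling T lab \<and>
    arboreal_action f x\<^sub>0 ` arboreal_galois_group f x\<^sub>0 \<subseteq> Q_tilde T lab l"
    by (rule galois_in_Q_tilde)
  have base: "s \<in> range to_ac \<longleftrightarrow> (\<exists>t :: 'a. t ^ 2 = - 3)"
  proof
    assume "s \<in> range to_ac"
    then obtain t where "s = to_ac t" by blast
    then have "to_ac (t\<^sup>2) = to_ac (-3)" using s by simp
    then show "\<exists>t :: 'a. t ^ 2 = - 3" unfolding to_ac_eq_iff by blast
  next
    assume "\<exists>t :: 'a. t ^ 2 = - 3"
    then obtain t :: 'a where "t\<^sup>2 = -3" ..
    then have "(to_ac t)\<^sup>2 = s\<^sup>2" unfolding s by (metis to_ac_minus to_ac_numeral to_ac_power)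
    then have "s = to_ac t \<or> s = to_ac (- t)" unfolding power2_eq_iff by auto
    then show "s \<in> range to_ac" by blast
  qed
  show "(\<exists>lab. tree_labeling T lab \<and>
      arboreal_action f x\<^sub>0 ` arboreal_galois_group f x\<^sub>0 \<subseteq> Q_group T lab l) \<longleftrightarrow>
    (\<exists>s :: 'a. s ^ 2 = - 3)"
    using galois_in_Q_group_of_base base_of_galois_in_Q_group base by blast
qed

end
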